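(* Let $A$ be an $\mathfrak h$-trivial formal deformation of the $\mathfrak a$-algebra $U(\mathfrak{sl}_2)$. Then there is a unique regular colouring $\psi$ such that $A$ and $U_h(\psi)$ are isomorphic as $U_h(\mathfrak a)$-algebras.
   Context: $\mathbb k$ is a field of characteristic zero, and $\mathbb k[[h]]$ is the ring of formal power series over $\mathbb k$. For a $\mathbb k$-vector space $V_0$, $V_0[[h]]$ denotes the module of formal series $\sum_{m\ge0}v_mh^m$ with $v_m\in V_0$. A $\mathbb k[[h]]$-module is topologically free if it is isomorphic to some $V_0[[h]]$. For a $\mathbb k[[h]]$-linear map $g$, $\bar g$ denotes the induced map modulo $h$. $\mathfrak a$ is the Lie algebra over $\mathbb k$ generated by $H,X^-,X^+$ subject to $[H,X^\pm]=\pm2X^\pm$. An $\mathfrak a$-algebra is an algebra with a structural homomorphism from $U(\mathfrak a)$; homomorphisms of such algebras commute with structural maps. $U(\mathfrak{sl}_2)$ is an $\mathfrak a$-algebra via the canonical projection. We set $U_h(\mathfrak a):=U(\mathfrak a)[[h]]$. For a $U_h(\mathfrak a)$-algebra $A$, the quotient $A/hA$ is an $\mathfrak a$-algebra. A formal deformation of the $\mathfrak a$-algebra $U(\mathfrak{sl}_2)$ is a $U_h(\mathfrak a)$-algebra $A$ that is topologically free as a $\mathbb k[[h]]$-module and satisfies $A/hA\cong U(\mathfrak{sl}_2)$ as $\mathfrak a$-algebras. The images of $H,X^\pm$ in $A$ are again denoted $H,X^\pm$. Such an $A$ is $\mathfrak h$-trivial if there is a $\mathbb k[[h]]$-algebra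 isomorphism $g:U(\mathfrak{sl}_2)[[h]]\to A$ with $g(H)=H$ and $\bar g:U(\mathfrak{sl}_2)\to A/hA$ an isomorphism of $\mathfrak a$-algebras. A colouring is a sequence $\psi=(\psi^k)_{k\ge1}$ of functions $\psi^k:\mathbb Z\to\mathbb k[[h]]$ satisfying: - (C1) $\psi^k(n)\equiv k(n-k+1)\bmod h$; - (C2) $\psi^{n+1}(n)=0$ for all $n\ge0$; - (C3) $\psi^{n+k+1}(n)=\psi^k(-n-2)$ for all $k\ge1$ and all $n\ge0$. Write $\psi^k(n)=\sum_m\psi^k_m(n)h^m$. The colouring $\psi$ is regular if, for each $m$, there is $P_m\in\mathbb k[x,y]$ with $\psi^k_m(n)=P_m(k,n)$ for all $k\ge1$ and $n\in\mathbb Z$. $V_h(n,\psi)$ is the representation of $U_h(\mathfrak a)$ on $(\bigoplus_{k\ge0}\mathbb k b_k)[[h]]$ with the following action: - $H.b_k=(n-2k)b_k$; - $X^-.b_k=b_{k+1}$; - $X^+.b_0=0$, and $X^+.b_k=\psi^k(n)b_{k-1}$ for $k\ge1$. $U_h(\psi)$ is the quotient of $U_h(\mathfrak a)$ by the two-sided ideal of elements that act by zero on all $V_h(n,\psi)$, $n\in\mathbb Z$. It is a $U_h(\mathfrak a)$-algebra via the projection. *)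

theory Defs
  imports "HOL-Computational_Algebra.Formal_Power_Series" "HOL-Computational_Algebra.Polynomial"
begin

text \<open>a is the Lie algebra generated by H, X-, X+ with [H,X+-] = +-2 X+-, i.e. the
semidirect product of k H with the free Lie algebra on X+, X-. By PBW, U(a) has the k-basis
w H^j, where w ranges over words in the letters X+ (True) and X- (False).
An element of U(a) is represented as a finitely supported map from words w to
polynomials p_w in H, standing for the finite sum of w p_w(H).
The relation p(H) w = w p(H + wt w), wt w = 2(#X+ - #X-), gives the product.\<close>

type_synonym 'k ua = "bool list \<Rightarrow> 'k poly"

definition ua_carrier :: "'k::field_char_0 ua set" where
  "ua_carrier = {u. finite {w. u w \<noteq> 0}}"

definition wt :: "bool list \<Rightarrow> int" where
  "wt w = sum_list (map (\<lambda>b. if b then 2 else -2) w)"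

definition ua_zero :: "'k::field_char_0 ua" where "ua_zero = (\<lambda>w. 0)"
definition ua_one :: "'k::field_char_0 ua" where "ua_one = (\<lambda>w. if w = [] then 1 else 0)"
definition ua_H :: "'k::field_char_0 ua" where "ua_H = (\<lambda>w. if w = [] then [:0, 1:] else 0)"
definition ua_Xp :: "'k::field_char_0 ua" where "ua_Xp = (\<lambda>w. if w = [True] then 1 else 0)"
definition ua_Xm :: "'k::field_char_0 ua" where "ua_Xm = (\<lambda>w. if w = [False] then 1 else 0)"
definition ua_add :: "'k::field_char_0 ua \<Rightarrow> 'k ua \<Rightarrow> 'k ua" where
  "ua_add u v = (\<lambda>w. u w + v w)"
definition ua_sub :: "'k::field_char_0 ua \<Rightarrow> 'k ua \<Rightarrow> 'k ua" where
  "ua_sub u v = (\<lambda>w. u w - v w)"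
definition ua_scale :: "'k::field_char_0 \<Rightarrow> 'k ua \<Rightarrow> 'k ua" where
  "ua_scale c u = (\<lambda>w. smult c (u w))"
definition ua_mult :: "'k::field_char_0 ua \<Rightarrow> 'k ua \<Rightarrow> 'k ua" where
  "ua_mult u v = (\<lambda>z. \<Sum>i\<le>length z.
      pcompose (u (take i z)) [:of_int (wt (drop i z)), 1:] * v (drop i z))"

type_synonym 'k uha = "nat \<Rightarrow> 'k ua"

definition uh_carrier :: "'k::field_char_0 uha set" where
  "uh_carrier = {u. \<forall>m. u m \<in> ua_carrier}"
definition uh_const :: "'k::field_char_0 ua \<Rightarrow> 'k uha" where
  "uh_const u = (\<lambda>m. if m = 0 then u else ua_zero)"
definition uh_one :: "'k::field_char_0 uha" where "uh_one = uh_const ua_one"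
definition uh_add :: "'k::field_char_0 uha \<Rightarrow> 'k uha \<Rightarrow> 'k uha" where
  "uh_add u v = (\<lambda>m. ua_add (u m) (v m))"
definition uh_sub :: "'k::field_char_0 uha \<Rightarrow> 'k uha \<Rightarrow> 'k uha" where
  "uh_sub u v = (\<lambda>m. ua_sub (u m) (v m))"
definition uh_mult :: "'k::field_char_0 uha \<Rightarrow> 'k uha \<Rightarrow> 'k uha" where
  "uh_mult u v = (\<lambda>m w. \<Sum>i\<le>m. ua_mult (u i) (v (m - i)) w)"
definition uh_smult :: "'k::field_char_0 fps \<Rightarrow> 'k uha \<Rightarrow> 'k uha" where
  "uh_smult c u = (\<lambda>m w. \<Sum>i\<le>m. smult (fps_nth c i) (u (m - i) w))"

text \<open>A colouring is psi :: nat => int => k[[h]], where only psi k for k >= 1 is meaningful.\<close>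

definition is_colouring :: "(nat \<Rightarrow> int \<Rightarrow> 'k::field_char_0 fps) \<Rightarrow> bool" where
  "is_colouring psi \<longleftrightarrow>
     (\<forall>k\<ge>1. \<forall>n::int. fps_nth (psi k n) 0 = of_nat k * (of_int n - of_nat k + 1)) \<and>
     (\<forall>n::nat. psi (n + 1) (int n) = 0) \<and>
     (\<forall>k\<ge>1. \<forall>n::nat. psi (n + k + 1) (int n) = psi k (- int n - 2))"

text \<open>Bivariate polynomials P in k[x,y] are represented as elements of (k[y])[x].\<close>
definition eval2 :: "'k::field_char_0 poly poly \<Rightarrow> 'k \<Rightarrow> 'k \<Rightarrow> 'k" where
  "eval2 P x y = poly (poly P [:x:]) y"

definition is_regular_colouring :: "(nat \<Rightarrow> int \<Rightarrow> 'k::field_char_0 fps) \<Rightarrow> bool" where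
  "is_regular_colouring psi \<longleftrightarrow> is_colouring psi \<and>
     (\<forall>m. \<exists>P. \<forall>k\<ge>1. \<forall>n::int. fps_nth (psi k n) m = eval2 P (of_nat k) (of_int n))"

text \<open>Elements of V_h(n,psi) = (direct sum of k b_k)[[h]] are maps v with v m k the coefficient
of h^m b_k, each v m finitely supported.\<close>
definition vh_carrier :: "(nat \<Rightarrow> nat \<Rightarrow> 'k::field_char_0) set" where
  "vh_carrier = {v. \<forall>m. finite {k. v m k \<noteq> 0}}"

text \<open>Action of a word w (rightmost letter acts first) on b_k: w.b_k = c b_j, result (c, j).\<close>
fun wact :: "(nat \<Rightarrow> int \<Rightarrow> 'k::field_char_0 fps) \<Rightarrow> int \<Rightarrow> bool list \<Rightarrow> nat \<Rightarrow> 'k fps \<times> nat" where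
  "wact psi n [] k = (1, k)"
| "wact psi n (x # w) k = (let (c, j) = wact psi n w k in
      if x then (if j = 0 then (0, 0) else (c * psi j n, j - 1)) else (c, j + 1))"

text \<open>The (k[[h]]-linear, h-adically continuous) action of U_h(a) on V_h(n,psi);
H acts on b_k by n - 2k.\<close>
definition vh_act :: "(nat \<Rightarrow> int \<Rightarrow> 'k::field_char_0 fps) \<Rightarrow> int \<Rightarrow> 'k uha
     \<Rightarrow> (nat \<Rightarrow> nat \<Rightarrow> 'k) \<Rightarrow> (nat \<Rightarrow> nat \<Rightarrow> 'k)" where
  "vh_act psi n u v = (\<lambda>m j. \<Sum>a\<le>m. \<Sum>b\<le>m - a. \<Sum>k\<in>{k. v b k \<noteq> 0}. \<Sum>w\<in>{w. u a w \<noteq> 0}.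
      (if snd (wact psi n w k) = j
       then v b k * poly (u a w) (of_int n - 2 * of_nat k) * fps_nth (fst (wact psi n w k)) (m - a - b)
       else 0))"

definition ann_ideal :: "(nat \<Rightarrow> int \<Rightarrow> 'k::field_char_0 fps) \<Rightarrow> 'k uha set" where
  "ann_ideal psi = {u \<in> uh_carrier. \<forall>n::int. \<forall>v\<in>vh_carrier. vh_act psi n u v = (\<lambda>m j. 0)}"

definition psi_cls :: "(nat \<Rightarrow> int \<Rightarrow> 'k::field_char_0 fps) \<Rightarrow> 'k uha \<Rightarrow> 'k uha set" where
  "psi_cls psi u = {v \<in> uh_carrier. uh_sub v u \<in> ann_ideal psi}"

definition Uh_psi :: "(nat \<Rightarrow> int \<Rightarrow> 'k::field_char_0 fps) \<Rightarrow> 'k uha set set" where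
  "Uh_psi psi = psi_cls psi ` uh_carrier"

definition fps_algebra :: "('k::field_char_0 fps \<Rightarrow> 'a::ring_1 \<Rightarrow> 'a) \<Rightarrow> bool" where
  "fps_algebra sm \<longleftrightarrow>
     (\<forall>c x y. sm c (x + y) = sm c x + sm c y) \<and>
     (\<forall>c d x. sm (c + d) x = sm c x + sm d x) \<and>
     (\<forall>c d x. sm (c * d) x = sm c (sm d x)) \<and>
     (\<forall>x. sm 1 x = x) \<and>
     (\<forall>c x y. sm c (x * y) = sm c x * y \<and> sm c (x * y) = x * sm c y)"

definition Uh_structure :: "('k::field_char_0 fps \<Rightarrow> 'a::ring_1 \<Rightarrow> 'a) \<Rightarrow> ('k uha \<Rightarrow> 'a) \<Rightarrow> bool" where
  "Uh_structure sm rho \<longleftrightarrow> fps_algebra sm \<and> rho uh_one = 1 \<and>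
     (\<forall>u\<in>uh_carrier. \<forall>v\<in>uh_carrier. rho (uh_add u v) = rho u + rho v \<and>
                                      rho (uh_mult u v) = rho u * rho v) \<and>
     (\<forall>c. \<forall>u\<in>uh_carrier. rho (uh_smult c u) = sm c (rho u))"

text \<open>Topological freeness: A is isomorphic as k[[h]]-module to V0[[h]] for a k-vector space
V0 (carrier type 'v, scalar action vs); e is the isomorphism.\<close>
definition k_vector_space :: "('k::field_char_0 \<Rightarrow> 'v::ab_group_add \<Rightarrow> 'v) \<Rightarrow> bool" where
  "k_vector_space vs \<longleftrightarrow>
     (\<forall>a x y. vs a (x + y) = vs a x + vs a y) \<and>
     (\<forall>a b x. vs (a + b) x = vs a x + vs b x) \<and>
     (\<forall>a b x. vs (a * b) x = vs a (vs b x)) \<and>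
     (\<forall>x. vs 1 x = x)"

definition ser_smult :: "('k::field_char_0 \<Rightarrow> 'v::ab_group_add \<Rightarrow> 'v) \<Rightarrow> 'k fps \<Rightarrow> (nat \<Rightarrow> 'v) \<Rightarrow> (nat \<Rightarrow> 'v)" where
  "ser_smult vs c f = (\<lambda>m. \<Sum>i\<le>m. vs (fps_nth c i) (f (m - i)))"

definition topologically_free_iso ::
  "('k::field_char_0 \<Rightarrow> 'v::ab_group_add \<Rightarrow> 'v) \<Rightarrow> ('k fps \<Rightarrow> 'a::ring_1 \<Rightarrow> 'a) \<Rightarrow> ((nat \<Rightarrow> 'v) \<Rightarrow> 'a) \<Rightarrow> bool" where
  "topologically_free_iso vs sm e \<longleftrightarrow> k_vector_space vs \<and> bij e \<and>
     (\<forall>f g. e (\<lambda>m. f m + g m) = e f + e g) \<and>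
     (\<forall>c f. e (ser_smult vs c f) = sm c (e f))"

definition sl2_rel :: "'k::field_char_0 ua" where
  "sl2_rel = ua_sub (ua_sub (ua_mult ua_Xp ua_Xm) (ua_mult ua_Xm ua_Xp)) ua_H"

inductive_set sl2_ideal :: "'k::field_char_0 ua set" where
  zero: "ua_zero \<in> sl2_ideal"
| add: "x \<in> sl2_ideal \<Longrightarrow> y \<in> sl2_ideal \<Longrightarrow> ua_add x y \<in> sl2_ideal"
| gen: "a \<in> ua_carrier \<Longrightarrow> b \<in> ua_carrier \<Longrightarrow> ua_mult (ua_mult a sl2_rel) b \<in> sl2_ideal"

definition sl2_cls :: "'k::field_char_0 ua \<Rightarrow> 'k ua set" where
  "sl2_cls u = {v \<in> ua_carrier. ua_sub v u \<in> sl2_ideal}"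

definition Usl2 :: "'k::field_char_0 ua set set" where
  "Usl2 = sl2_cls ` ua_carrier"

definition rep :: "'x set \<Rightarrow> 'x" where "rep C = (SOME u. u \<in> C)"

definition modh :: "('k::field_char_0 fps \<Rightarrow> 'a::ring_1 \<Rightarrow> 'a) \<Rightarrow> 'a \<Rightarrow> 'a set" where
  "modh sm a = {b. b - a \<in> range (sm fps_X)}"

text \<open>An isomorphism of a-algebras phi : U(sl2) -> A/hA (structure maps: the projection
U(a) -> U(sl2), and U(a) -> A/hA induced by rho).\<close>
definition a_alg_iso_sl2 ::
  "('k::field_char_0 fps \<Rightarrow> 'a::ring_1 \<Rightarrow> 'a) \<Rightarrow> ('k uha \<Rightarrow> 'a) \<Rightarrow> ('k ua set \<Rightarrow> 'a set) \<Rightarrow> bool" where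
  "a_alg_iso_sl2 sm rho phi \<longleftrightarrow>
     bij_betw phi Usl2 (range (modh sm)) \<and>
     phi (sl2_cls ua_one) = modh sm 1 \<and>
     (\<forall>u\<in>ua_carrier. \<forall>v\<in>ua_carrier. \<forall>a b. phi (sl2_cls u) = modh sm a \<longrightarrow> phi (sl2_cls v) = modh sm b \<longrightarrow>
        phi (sl2_cls (ua_add u v)) = modh sm (a + b) \<and>
        phi (sl2_cls (ua_mult u v)) = modh sm (a * b)) \<and>
     (\<forall>c. \<forall>u\<in>ua_carrier. \<forall>a. phi (sl2_cls u) = modh sm a \<longrightarrow>
        phi (sl2_cls (ua_scale c u)) = modh sm (sm (fps_const c) a)) \<and>
     (\<forall>u\<in>ua_carrier. phi (sl2_cls u) = modh sm (rho (uh_const u)))"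

text \<open>Formal deformation of U(sl2): topologically free (hypothesis given separately) and
A/hA isomorphic to U(sl2) as a-algebras.\<close>
definition deformation_of_Usl2 :: "('k::field_char_0 fps \<Rightarrow> 'a::ring_1 \<Rightarrow> 'a) \<Rightarrow> ('k uha \<Rightarrow> 'a) \<Rightarrow> bool" where
  "deformation_of_Usl2 sm rho \<longleftrightarrow> Uh_structure sm rho \<and> (\<exists>phi. a_alg_iso_sl2 sm rho phi)"

definition usl2h_carrier :: "(nat \<Rightarrow> 'k::field_char_0 ua set) set" where
  "usl2h_carrier = {s. \<forall>m. s m \<in> Usl2}"
definition usl2h_const :: "'k::field_char_0 ua set \<Rightarrow> nat \<Rightarrow> 'k ua set" where
  "usl2h_const C = (\<lambda>m. if m = 0 then C else sl2_cls ua_zero)"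
definition usl2h_add :: "(nat \<Rightarrow> 'k::field_char_0 ua set) \<Rightarrow> (nat \<Rightarrow> 'k ua set) \<Rightarrow> nat \<Rightarrow> 'k ua set" where
  "usl2h_add s t = (\<lambda>m. sl2_cls (ua_add (rep (s m)) (rep (t m))))"
definition usl2h_mult :: "(nat \<Rightarrow> 'k::field_char_0 ua set) \<Rightarrow> (nat \<Rightarrow> 'k ua set) \<Rightarrow> nat \<Rightarrow> 'k ua set" where
  "usl2h_mult s t = (\<lambda>m. sl2_cls (\<lambda>w. \<Sum>i\<le>m. ua_mult (rep (s i)) (rep (t (m - i))) w))"
definition usl2h_smult :: "'k::field_char_0 fps \<Rightarrow> (nat \<Rightarrow> 'k ua set) \<Rightarrow> nat \<Rightarrow> 'k ua set" where
  "usl2h_smult c s = (\<lambda>m. sl2_cls (\<lambda>w. \<Sum>i\<le>m. smult (fps_nth c i) (rep (s (m - i)) w)))"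

definition h_trivial :: "('k::field_char_0 fps \<Rightarrow> 'a::ring_1 \<Rightarrow> 'a) \<Rightarrow> ('k uha \<Rightarrow> 'a) \<Rightarrow> bool" where
  "h_trivial sm rho \<longleftrightarrow> (\<exists>g.
     bij_betw g usl2h_carrier UNIV \<and>
     g (usl2h_const (sl2_cls ua_one)) = 1 \<and>
     (\<forall>s\<in>usl2h_carrier. \<forall>t\<in>usl2h_carrier.
        g (usl2h_add s t) = g s + g t \<and> g (usl2h_mult s t) = g s * g t) \<and>
     (\<forall>c. \<forall>s\<in>usl2h_carrier. g (usl2h_smult c s) = sm c (g s)) \<and>
     g (usl2h_const (sl2_cls ua_H)) = rho (uh_const ua_H) \<and>
     a_alg_iso_sl2 sm rho (\<lambda>C. modh sm (g (usl2h_const C))))"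

definition Uh_alg_iso_Uh_psi ::
  "('k::field_char_0 fps \<Rightarrow> 'a::ring_1 \<Rightarrow> 'a) \<Rightarrow> ('k uha \<Rightarrow> 'a) \<Rightarrow> (nat \<Rightarrow> int \<Rightarrow> 'k fps) \<Rightarrow> bool" where
  "Uh_alg_iso_Uh_psi sm rho psi \<longleftrightarrow> (\<exists>Phi.
     bij_betw Phi (Uh_psi psi) UNIV \<and>
     Phi (psi_cls psi uh_one) = 1 \<and>
     (\<forall>u\<in>uh_carrier. \<forall>v\<in>uh_carrier.
        Phi (psi_cls psi (uh_add u v)) = Phi (psi_cls psi u) + Phi (psi_cls psi v) \<and>
        Phi (psi_cls psi (uh_mult u v)) = Phi (psi_cls psi u) * Phi (psi_cls psi v)) \<and>
     (\<forall>c. \<forall>u\<in>uh_carrier. Phi (psi_cls psi (uh_smult c u)) = sm c (Phi (psi_cls psi u))) \<and>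
     (\<forall>u\<in>uh_carrier. Phi (psi_cls psi u) = rho u))"

end

theory Submission
  imports Defs "HOL-Library.Function_Algebras"
begin

text \<open>Through the trivialization, A acts on the Verma modules M(n)[[h]] of U(sl2)[[h]]. There x- maps
v_j to a(j,n) v_(j+1) and x+ maps v_j to b(j,n) v_(j-1), since they are weight vectors for H. Each
h-coefficient of a and b is a polynomial in j and n, and a is congruent to 1 modulo h. In the basis
(x-)^k v_0 the module becomes V_h(n,psi) with psi^k(n) = b(k,n) a(k-1,n). The inclusion of M(-n-2)
into M(n), that is, the symmetry (n, n+1+k) <-> (-n-2, k) of all matrix coefficients, gives (C2)
and (C3). U(sl2) acts faithfully on the sum of its Verma modules, so the kernel of the structure map
U_h(a) -> A is the annihilator of the V_h(n,psi), and this map is surjective by successive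
approximation modulo powers of h.

For uniqueness, the kernel determines how U_h(a) acts on highest weight vectors: modulo the kernel
and h every element is a combination of the words (X-)^i (X+)^l, whose action on b_0 does not involve
psi. Applied to (X+)^k (X-)^k this yields the products psi^1(n) ... psi^k(n), from which the factors
can be cancelled as long as k <= n+1 or n < 0; (C3) determines the rest.\<close>

section \<open>The enveloping algebra of a\<close>

text \<open>The induction method eta-expands function-typed terms, and these rules would then rewrite
under the lambda.\<close>
declare plus_fun_apply [simp del] zero_fun_apply [simp del]
  minus_apply [simp del] uminus_apply [simp del] pcompose_1 [simp]

lemma sum_fun_apply: "(\<Sum>i\<in>I. f i) x = (\<Sum>i\<in>I. f i x)"
  by (induction I rule: infinite_finite_induct) (auto simp: plus_fun_apply zero_fun_apply)

lemma ua_add_eq: "ua_add u v = u + v"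
  by (simp add: ua_add_def plus_fun_def)

lemma ua_sub_eq: "ua_sub u v = u - v"
  by (simp add: ua_sub_def fun_diff_def)

lemma ua_zero_eq: "ua_zero = 0"
  by (simp add: ua_zero_def zero_fun_def)

lemma uh_add_eq: "uh_add u v = u + v"
  by (simp add: uh_add_def ua_add_eq plus_fun_def)

lemma uh_sub_eq: "uh_sub u v = u - v"
  by (simp add: uh_sub_def ua_sub_eq fun_diff_def)

definition ua_mono :: "bool list \<Rightarrow> 'k::field_char_0 poly \<Rightarrow> 'k ua" where
  "ua_mono w p = (\<lambda>z. if z = w then p else 0)"

lemma ua_one_eq: "ua_one = ua_mono [] 1"
  and ua_H_eq: "ua_H = ua_mono [] [:0, 1:]"
  and ua_Xp_eq: "ua_Xp = ua_mono [True] 1"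
  and ua_Xm_eq: "ua_Xm = ua_mono [False] 1"
  by (simp_all add: ua_one_def ua_H_def ua_Xp_def ua_Xm_def ua_mono_def)

lemma ua_mono_add: "ua_mono w (p + q) = ua_mono w p + ua_mono w q"
  by (auto simp: ua_mono_def fun_eq_iff plus_fun_apply zero_fun_apply)

lemma ua_mono_0 [simp]: "ua_mono w 0 = 0"
  by (auto simp: ua_mono_def fun_eq_iff plus_fun_apply zero_fun_apply)

lemma ua_mono_carrier [simp]: "ua_mono w p \<in> ua_carrier"
  by (auto simp: ua_carrier_def ua_mono_def intro: finite_subset[of _ "{w}"])

lemma ua_carrier_0 [simp]: "0 \<in> ua_carrier"
  by (simp add: ua_carrier_def zero_fun_apply)

lemma ua_carrier_add [simp]:
  assumes "u \<in> ua_carrier" "v \<in> ua_carrier"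
  shows "u + v \<in> ua_carrier"
proof -
  have "{w. (u + v) w \<noteq> 0} \<subseteq> {w. u w \<noteq> 0} \<union> {w. v w \<noteq> 0}" by (auto simp: plus_fun_apply)
  with assms show ?thesis by (auto simp: ua_carrier_def intro: finite_subset)
qed

lemma ua_carrier_uminus [simp]: "u \<in> ua_carrier \<Longrightarrow> - u \<in> ua_carrier"
  by (simp add: ua_carrier_def uminus_apply)

lemma ua_carrier_diff [simp]:
  "u \<in> ua_carrier \<Longrightarrow> v \<in> ua_carrier \<Longrightarrow> u - v \<in> ua_carrier"
  using ua_carrier_add[of u "- v"] by simp

lemma ua_carrier_sum:
  assumes "\<And>i. i \<in> I \<Longrightarrow> f i \<in> ua_carrier"
  shows "(\<Sum>i\<in>I. f i) \<in> ua_carrier"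
  using assms by (induction I rule: infinite_finite_induct) auto

text \<open>Statements additive in u need to be checked only on the pieces w p(H) of the PBW
  decomposition.\<close>

lemma ua_carrier_induct [consumes 1, case_names zero mono add]:
  assumes "u \<in> ua_carrier"
    and zero: "P 0"
    and mono: "\<And>w p. P (ua_mono w p)"
    and add: "\<And>u v. u \<in> ua_carrier \<Longrightarrow> v \<in> ua_carrier \<Longrightarrow> P u \<Longrightarrow> P v \<Longrightarrow> P (u + v)"
  shows "P u"
proof -
  \<comment> \<open>The support may be smaller than S, so that deleting the entry at one word leaves
    a case of the induction hypothesis.\<close>
  have "P u" if "finite S" "{w. u w \<noteq> 0} \<subseteq> S" for S u
    using that
  proof (induction S arbitrary: u rule: finite_induct)
    case empty
    then have "u = 0" by (auto simp: fun_eq_iff zero_fun_apply)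
    with zero show ?case by simp
  next
    case (insert w S)
    have "{z. (u(w := 0)) z \<noteq> 0} \<subseteq> S" using insert.prems by auto
    moreover from this have "u(w := 0) \<in> ua_carrier"
      using insert.hyps(1) unfolding ua_carrier_def mem_Collect_eq by (rule finite_subset)
    moreover have "u = ua_mono w (u w) + u(w := 0)"
      by (auto simp: ua_mono_def fun_eq_iff plus_fun_apply zero_fun_apply)
    ultimately show ?case using add mono insert.IH by (metis ua_mono_carrier)
  qed
  with assms(1) show ?thesis by (auto simp: ua_carrier_def)
qed

lemma ua_mult_add_left: "ua_mult (u + v) x = ua_mult u x + ua_mult v x"
  by (simp add: ua_mult_def fun_eq_iff plus_fun_apply zero_fun_apply pcompose_add algebra_simps sum.distrib)

lemma ua_mult_add_right: "ua_mult x (u + v) = ua_mult x u + ua_mult x v"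
  by (simp add: ua_mult_def fun_eq_iff plus_fun_apply zero_fun_apply algebra_simps sum.distrib)

lemma ua_mult_0_left [simp]: "ua_mult 0 x = 0"
  and ua_mult_0_right [simp]: "ua_mult x 0 = 0"
  by (simp_all add: ua_mult_def fun_eq_iff plus_fun_apply zero_fun_apply)

lemma ua_mult_uminus_left: "ua_mult (- u) x = - ua_mult u x"
  using ua_mult_add_left[of u "- u" x] by (simp add: eq_neg_iff_add_eq_0 add.commute)

lemma ua_mult_uminus_right: "ua_mult x (- u) = - ua_mult x u"
  using ua_mult_add_right[of x u "- u"] by (simp add: eq_neg_iff_add_eq_0 add.commute)

lemma ua_mult_diff_left: "ua_mult (u - v) x = ua_mult u x - ua_mult v x"
  using ua_mult_add_left[of u "- v" x] by (simp add: ua_mult_uminus_left)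

lemma ua_mult_diff_right: "ua_mult x (u - v) = ua_mult x u - ua_mult x v"
  using ua_mult_add_right[of x u "- v"] by (simp add: ua_mult_uminus_right)

text \<open>Moving p(H) to the right past z shifts its argument by \<open>wt z\<close>. Of all cuts
  of a word x only the one after \<open>length w\<close> letters can contribute, and only for x = w
  z.\<close>

lemma ua_mult_mono:
  "ua_mult (ua_mono w p) (ua_mono z q) =
     ua_mono (w @ z) (pcompose p [:of_int (wt z), 1:] * q)"
proof
  fix x
  have split: "take i x = w \<and> drop i x = z \<longleftrightarrow> i = length w \<and> x = w @ z" if "i \<le> length x" for i
    using that by (auto simp: min_def)
  have "ua_mult (ua_mono w p) (ua_mono z q) x =
      (\<Sum>i\<le>length x. if i = length w \<and> x = w @ z then pcompose p [:of_int (wt z), 1:] * q else 0)"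
    unfolding ua_mult_def ua_mono_def using split by (intro sum.cong) auto
  also have "\<dots> = ua_mono (w @ z) (pcompose p [:of_int (wt z), 1:] * q) x"
    by (auto simp: ua_mono_def)
  finally show "ua_mult (ua_mono w p) (ua_mono z q) x =
      ua_mono (w @ z) (pcompose p [:of_int (wt z), 1:] * q) x" .
qed

lemma ua_mult_carrier [simp]:
  assumes "u \<in> ua_carrier" "v \<in> ua_carrier"
  shows "ua_mult u v \<in> ua_carrier"
  using assms(1)
proof (induction rule: ua_carrier_induct)
  case (mono w p)
  from assms(2) show ?case
    by (induction rule: ua_carrier_induct) (auto simp: ua_mult_mono ua_mult_add_right)
qed (auto simp: ua_mult_add_left)

lemma wt_append: "wt (w @ z) = wt w + wt z"
  by (simp add: wt_def)

text \<open>On monomials, both bracketings shift p by the weights of z and of the third word, and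
  \<open>wt\<close> is additive.\<close>

lemma ua_mult_assoc:
  assumes "u \<in> ua_carrier" "v \<in> ua_carrier" "x \<in> ua_carrier"
  shows "ua_mult (ua_mult u v) x = ua_mult u (ua_mult v x)"
  using assms(1)
proof (induction rule: ua_carrier_induct)
  case (mono w p)
  from assms(2) show ?case
  proof (induction rule: ua_carrier_induct)
    case (mono z q)
    from assms(3) show ?case
      by (induction rule: ua_carrier_induct)
        (simp_all add: ua_mult_mono ua_mult_add_right pcompose_mult wt_append
          pcompose_pCons mult.assoc flip: pcompose_assoc)
  qed (auto simp: ua_mult_add_left ua_mult_add_right)
qed (auto simp: ua_mult_add_left)

section \<open>Series in h with coefficients in U(a)\<close>

lemma uh_carrierI: "(\<And>m. u m \<in> ua_carrier) \<Longrightarrow> u \<in> uh_carrier"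
  by (simp add: uh_carrier_def)

lemma uh_carrierD: "u \<in> uh_carrier \<Longrightarrow> u m \<in> ua_carrier"
  by (simp add: uh_carrier_def)

lemma uh_carrier_0 [simp]: "0 \<in> uh_carrier"
  and uh_carrier_add [simp]: "u \<in> uh_carrier \<Longrightarrow> v \<in> uh_carrier \<Longrightarrow> u + v \<in> uh_carrier"
  and uh_carrier_diff [simp]: "u \<in> uh_carrier \<Longrightarrow> v \<in> uh_carrier \<Longrightarrow> u - v \<in> uh_carrier"
  by (auto simp: uh_carrier_def plus_fun_apply zero_fun_apply minus_apply)

lemma uh_const_carrier [simp]: "u \<in> ua_carrier \<Longrightarrow> uh_const u \<in> uh_carrier"
  by (auto simp: uh_carrier_def uh_const_def ua_zero_eq)

lemma uh_mult_eq: "uh_mult u v m = (\<Sum>i\<le>m. ua_mult (u i) (v (m - i)))"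
  by (rule ext) (simp add: uh_mult_def sum_fun_apply)

lemma uh_mult_carrier [simp]:
  "u \<in> uh_carrier \<Longrightarrow> v \<in> uh_carrier \<Longrightarrow> uh_mult u v \<in> uh_carrier"
  by (auto simp: uh_carrier_def uh_mult_eq intro!: ua_carrier_sum)

lemma uh_const_mult: "uh_mult (uh_const u) (uh_const v) = uh_const (ua_mult u v)"
proof
  fix m
  have "uh_mult (uh_const u) (uh_const v) m =
      (\<Sum>i\<le>m. if i = 0 then ua_mult u (uh_const v m) else 0)"
    unfolding uh_mult_eq by (intro sum.cong) (auto simp: uh_const_def ua_zero_eq)
  then show "uh_mult (uh_const u) (uh_const v) m = uh_const (ua_mult u v) m"
    by (simp add: uh_const_def ua_zero_eq)
qed

lemma uh_const_add: "uh_const (u + v) = uh_const u + uh_const v"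
  by (auto simp: uh_const_def fun_eq_iff plus_fun_apply zero_fun_apply ua_zero_eq)

lemma uh_const_0 [simp]: "uh_const 0 = 0"
  by (auto simp: uh_const_def fun_eq_iff plus_fun_apply zero_fun_apply ua_zero_eq)

definition uh_shift :: "'k::field_char_0 uha \<Rightarrow> 'k uha" where
  "uh_shift u = (\<lambda>m. u (Suc m))"

lemma uh_shift_carrier [simp]: "u \<in> uh_carrier \<Longrightarrow> uh_shift u \<in> uh_carrier"
  by (auto simp: uh_carrier_def uh_shift_def)

lemma uh_smult_X: "uh_smult fps_X u = (\<lambda>m. if m = 0 then 0 else u (m - 1))"
proof (intro ext)
  fix m w
  have "uh_smult fps_X u m w = (\<Sum>i\<le>m. if i = 1 then u (m - 1) w else 0)"
    unfolding uh_smult_def by (intro sum.cong) auto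
  then show "uh_smult fps_X u m w = (if m = 0 then 0 else u (m - 1)) w"
    by (auto simp: zero_fun_apply)
qed

lemma uh_smult_carrier [simp]:
  assumes "u \<in> uh_carrier"
  shows "uh_smult c u \<in> uh_carrier"
  unfolding uh_smult_def
proof (rule uh_carrierI)
  fix m
  have "{w. (\<Sum>i\<le>m. smult (fps_nth c i) (u (m - i) w)) \<noteq> 0} \<subseteq> (\<Union>i\<le>m. {w. u (m - i) w \<noteq> 0})"
    by (auto intro: ccontr)
  moreover have "finite (\<Union>i\<le>m. {w. u (m - i) w \<noteq> 0})"
    using assms by (auto simp: uh_carrier_def ua_carrier_def)
  ultimately show "(\<lambda>w. \<Sum>i\<le>m. smult (fps_nth c i) (u (m - i) w)) \<in> ua_carrier"
    unfolding ua_carrier_def by (auto elim: finite_subset)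
qed

lemma uh_smult_const_mono:
  "uh_smult (fps_const c) (uh_const (ua_mono w p)) = uh_const (ua_mono w (smult c p))"
proof (intro ext)
  fix m z
  have "uh_smult (fps_const c) (uh_const (ua_mono w p)) m z =
      (\<Sum>i\<le>m. if i = 0 then smult c (uh_const (ua_mono w p) m z) else 0)"
    unfolding uh_smult_def by (intro sum.cong) auto
  then show "uh_smult (fps_const c) (uh_const (ua_mono w p)) m z = uh_const (ua_mono w (smult c p)) m z"
    by (auto simp: uh_const_def ua_mono_def ua_zero_def)
qed

text \<open>One step of the h-adic expansion. Arguments by induction on the order in h split off
  \<open>u 0\<close> in this way and continue with \<open>uh_shift u\<close>.\<close>

lemma uh_decompose: "u = uh_const (u 0) + uh_smult fps_X (uh_shift u)"
  by (rule ext) (simp add: uh_smult_X uh_const_def uh_shift_def ua_zero_eq plus_fun_apply)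

section \<open>Matrix coefficients\<close>

text \<open>Half the H-weight. It is the number of steps by which a word lowers the index of a basis
  vector, since X+ lowers it by one and X- raises it by one.\<close>

definition wdeg :: "bool list \<Rightarrow> int" where
  "wdeg w = sum_list (map (\<lambda>b. if b then 1 else -1) w)"

lemma wdeg_simps [simp]:
  "wdeg [] = 0" "wdeg (x # w) = (if x then 1 else -1) + wdeg w" "wdeg (w @ z) = wdeg w + wdeg z"
  by (simp_all add: wdeg_def)

lemma wt_eq: "wt w = 2 * wdeg w"
  by (induction w) (simp_all add: wt_def wdeg_def)

text \<open>Matrix coefficients on a basis b_j, j an integer, with X- b_j = a j b_(j+1) and
X+ b_j = b j b_(j-1): the word w sends b_j to the multiple word_coeff a b w j of b_(j - wdeg w).
If b 0 = 0, the span of the b_j with j >= 0 is stable.\<close>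

fun word_coeff :: "(int \<Rightarrow> 'r) \<Rightarrow> (int \<Rightarrow> 'r) \<Rightarrow> bool list \<Rightarrow> int \<Rightarrow> 'r::comm_ring_1" where
  "word_coeff a b [] j = 1"
| "word_coeff a b (x # w) j =
     word_coeff a b w j * (if x then b (j - wdeg w) else a (j - wdeg w))"

lemma word_coeff_append:
  "word_coeff a b (w @ z) j = word_coeff a b z j * word_coeff a b w (j - wdeg z)"
  by (induction w) (auto simp: algebra_simps)

text \<open>Words act from the right, so on the way from j >= 0 to a negative index X+ must at some
  moment be applied at index 0, which contributes the factor \<open>b 0\<close>.\<close>

lemma word_coeff_eq_0:
  assumes "b 0 = 0" "0 \<le> j" "j < wdeg w"
  shows "word_coeff a b w j = 0"
  using assms(3)
proof (induction w)
  case (Cons x w)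
  show ?case
  proof (cases "j < wdeg w")
    case False
    with Cons.prems have "x" "j - wdeg w = 0" by (auto split: if_splits)
    then show ?thesis using assms(1) by simp
  qed (use Cons.IH in simp)
qed (use assms in simp)

text \<open>The coefficient of b_(j-d) in u b_j, where H acts on b_j by n - 2 j. In w p(H) the
  polynomial acts first, hence is evaluated at the weight of b_j itself.\<close>

definition mat_ua :: "(int \<Rightarrow> 'k fps) \<Rightarrow> (int \<Rightarrow> 'k fps) \<Rightarrow> int \<Rightarrow> 'k::field_char_0 ua
    \<Rightarrow> int \<Rightarrow> int \<Rightarrow> 'k fps" where
  "mat_ua a b n u j d = (\<Sum>w\<in>{w. u w \<noteq> 0}.
     if wdeg w = d then fps_const (poly (u w) (of_int (n - 2 * j))) * word_coeff a b w j else 0)"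

lemma mat_ua_superset:
  assumes "finite S" "{w. u w \<noteq> 0} \<subseteq> S"
  shows "mat_ua a b n u j d = (\<Sum>w\<in>S.
     if wdeg w = d then fps_const (poly (u w) (of_int (n - 2 * j))) * word_coeff a b w j else 0)"
  unfolding mat_ua_def using assms by (intro sum.mono_neutral_left) auto

lemma mat_ua_0 [simp]: "mat_ua a b n 0 j d = 0"
  by (simp add: mat_ua_def zero_fun_apply)

lemma mat_ua_add:
  assumes "u \<in> ua_carrier" "v \<in> ua_carrier"
  shows "mat_ua a b n (u + v) j d = mat_ua a b n u j d + mat_ua a b n v j d"
proof -
  let ?S = "{w. u w \<noteq> 0} \<union> {w. v w \<noteq> 0}"
  have fin: "finite ?S" using assms by (simp add: ua_carrier_def)
  have "{w. (u + v) w \<noteq> 0} \<subseteq> ?S" by (auto simp: plus_fun_apply)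
  then show ?thesis
    using fin mat_ua_superset[OF fin, of u] mat_ua_superset[OF fin, of v]
    by (simp add: mat_ua_superset[OF fin] flip: sum.distrib)
      (intro sum.cong, auto simp: plus_fun_apply algebra_simps simp flip: fps_const_add)
qed

lemma mat_ua_diff:
  assumes "u \<in> ua_carrier" "v \<in> ua_carrier"
  shows "mat_ua a b n (u - v) j d = mat_ua a b n u j d - mat_ua a b n v j d"
  using mat_ua_add[of "u - v" v] assms by (simp add: algebra_simps)

lemma mat_ua_sum:
  assumes "\<And>i. i \<in> I \<Longrightarrow> f i \<in> ua_carrier"
  shows "mat_ua a b n (\<Sum>i\<in>I. f i) j d = (\<Sum>i\<in>I. mat_ua a b n (f i) j d)"
  using assms
  by (induction I rule: infinite_finite_induct) (auto simp: mat_ua_add ua_carrier_sum)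

lemma mat_ua_mono: "mat_ua a b n (ua_mono w p) j d =
    (if wdeg w = d then fps_const (poly p (of_int (n - 2 * j))) * word_coeff a b w j else 0)"
  by (subst mat_ua_superset[of "{w}"]) (auto simp: ua_mono_def)

lemma mat_ua_mult_mono:
  assumes "u \<in> ua_carrier"
  shows "mat_ua a b n (ua_mult u (ua_mono z q)) j d =
    mat_ua a b n (ua_mono z q) j (wdeg z) * mat_ua a b n u (j - wdeg z) (d - wdeg z)"
  using assms
proof (induction rule: ua_carrier_induct)
  case (mono w p)
  \<comment> \<open>The shift of p by \<open>wt z\<close> is the change of weight from b_j to b_(j -
    wdeg z).\<close>
  have "of_int (wt z) + (of_int (n - 2 * j) :: 'a) = of_int (n - 2 * (j - wdeg z))"
    by (simp add: wt_eq algebra_simps)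
  then show ?case
    by (simp add: ua_mult_mono mat_ua_mono word_coeff_append poly_pcompose
        eq_diff_eq ac_simps del: of_int_diff of_int_mult flip: fps_const_mult)
qed (auto simp: ua_mult_add_left mat_ua_add algebra_simps)

text \<open>Matrix multiplication in which only one intermediate index survives. Homogeneity of u is
  required only of its matrix coefficients, since lifts of elements of A are controlled only through
  their action.\<close>

lemma mat_ua_mult:
  assumes "v \<in> ua_carrier" "u \<in> ua_carrier"
    and hom: "\<And>j d. d \<noteq> e \<Longrightarrow> mat_ua a b n u j d = 0"
  shows "mat_ua a b n (ua_mult u v) j d =
    mat_ua a b n v j (d - e) * mat_ua a b n u (j - (d - e)) e"
  using assms(1)
proof (induction rule: ua_carrier_induct)
  case (mono z q)
  show ?case
  proof (cases "wdeg z = d - e")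
    case True
    then show ?thesis using assms(2) by (simp add: mat_ua_mult_mono)
  next
    case False
    then have "d - wdeg z \<noteq> e" by auto
    with False show ?thesis using assms(2) by (simp add: mat_ua_mult_mono hom mat_ua_mono)
  qed
qed (auto simp: ua_mult_add_right mat_ua_add assms(2) algebra_simps)

text \<open>This makes the annihilator of the module a two-sided ideal. If v acts by zero, u is
  expanded into monomials, which are homogeneous.\<close>

lemma mat_ua_mult_eq_0:
  assumes "u \<in> ua_carrier" "v \<in> ua_carrier"
    and "(\<forall>j d. mat_ua a b n u j d = 0) \<or> (\<forall>j d. mat_ua a b n v j d = 0)"
  shows "mat_ua a b n (ua_mult u v) j d = 0"
  using assms(3)
proof
  assume "\<forall>j d. mat_ua a b n u j d = 0"
  \<comment> \<open>An element acting by zero is homogeneous of every degree, so any degree serves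
    here.\<close>
  with assms mat_ua_mult[of v u _ a b n] show ?thesis by simp
next
  assume v: "\<forall>j d. mat_ua a b n v j d = 0"
  from assms(1) show ?thesis
  proof (induction rule: ua_carrier_induct)
    case (mono w p)
    have "mat_ua a b n (ua_mult (ua_mono w p) v) j d = mat_ua a b n v j (d - wdeg w) *
        mat_ua a b n (ua_mono w p) (j - (d - wdeg w)) (wdeg w)"
      by (rule mat_ua_mult) (auto simp: assms mat_ua_mono)
    with v show ?case by simp
  qed (auto simp: ua_mult_add_left mat_ua_add assms(2))
qed

section \<open>h-adically convergent sums of f_i h^i, and matrix coefficients of U_h(a)\<close>

definition fps_glue :: "(nat \<Rightarrow> 'k::comm_ring_1 fps) \<Rightarrow> 'k fps" where
  "fps_glue f = Abs_fps (\<lambda>m. \<Sum>i\<le>m. fps_nth (f i) (m - i))"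

lemma fps_glue_decompose: "fps_glue f = f 0 + fps_X * fps_glue (\<lambda>i. f (Suc i))"
proof (rule fps_ext)
  fix m
  show "fps_nth (fps_glue f) m = fps_nth (f 0 + fps_X * fps_glue (\<lambda>i. f (Suc i))) m"
    by (cases m) (simp_all add: fps_glue_def sum.atMost_Suc_shift del: sum.atMost_Suc)
qed

lemma fps_glue_add: "fps_glue (\<lambda>i. f i + g i) = fps_glue f + fps_glue g"
  by (simp add: fps_glue_def fps_eq_iff sum.distrib)

lemma fps_glue_0 [simp]: "fps_glue (\<lambda>i. 0) = 0"
  by (simp add: fps_glue_def fps_eq_iff)

lemma fps_glue_cmult: "fps_glue (\<lambda>i. c * f i) = c * fps_glue f"
proof -
  have "fps_nth (fps_glue (\<lambda>i. c * f i)) m = fps_nth (c * fps_glue f) m" for m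
  proof (induction m arbitrary: f rule: less_induct)
    case (less m)
    have *: "c * fps_glue f = c * f 0 + fps_X * (c * fps_glue (\<lambda>i. f (Suc i)))"
      by (subst fps_glue_decompose) (simp add: algebra_simps)
    show ?case
      unfolding * by (subst fps_glue_decompose) (simp add: less.IH)
  qed
  then show ?thesis by (simp add: fps_eq_iff)
qed

text \<open>Splitting off f_0 leaves h times the same identity for the shifted sequence, so the
  coefficients agree by induction on their index.\<close>

lemma fps_glue_mult:
  "fps_glue (\<lambda>m. \<Sum>i\<le>m. f i * g (m - i)) = fps_glue f * fps_glue g"
proof -
  have "fps_nth (fps_glue (\<lambda>m. \<Sum>i\<le>m. f i * g (m - i))) m = fps_nth (fps_glue f * fps_glue g) m"
    for m
  proof (induction m arbitrary: f rule: less_induct)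
    case (less m)
    have "fps_glue (\<lambda>m. \<Sum>i\<le>m. f i * g (m - i)) = f 0 * g 0 +
        fps_X * fps_glue (\<lambda>m. f 0 * g (Suc m) + (\<Sum>i\<le>m. f (Suc i) * g (m - i)))"
      by (subst fps_glue_decompose) (simp add: sum.atMost_Suc_shift del: sum.atMost_Suc)
    also have "\<dots> = f 0 * fps_glue g + fps_X * fps_glue (\<lambda>m. \<Sum>i\<le>m. f (Suc i) * g (m - i))"
      by (subst (2) fps_glue_decompose) (simp add: fps_glue_add fps_glue_cmult algebra_simps)
    finally have 1: "fps_glue (\<lambda>m. \<Sum>i\<le>m. f i * g (m - i)) =
        f 0 * fps_glue g + fps_X * fps_glue (\<lambda>m. \<Sum>i\<le>m. f (Suc i) * g (m - i))" .
    have 2: "fps_glue f * fps_glue g =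
        f 0 * fps_glue g + fps_X * (fps_glue (\<lambda>i. f (Suc i)) * fps_glue g)"
      by (subst fps_glue_decompose) (simp add: algebra_simps)
    show ?case unfolding 1 2 by (simp add: less.IH)
  qed
  then show ?thesis by (simp add: fps_eq_iff)
qed

definition mat_uh :: "(int \<Rightarrow> 'k fps) \<Rightarrow> (int \<Rightarrow> 'k fps) \<Rightarrow> int \<Rightarrow> 'k::field_char_0 uha
    \<Rightarrow> int \<Rightarrow> int \<Rightarrow> 'k fps" where
  "mat_uh a b n u j d = fps_glue (\<lambda>i. mat_ua a b n (u i) j d)"

lemma mat_uh_add:
  assumes "u \<in> uh_carrier" "v \<in> uh_carrier"
  shows "mat_uh a b n (u + v) j d = mat_uh a b n u j d + mat_uh a b n v j d"
  using assms by (simp add: mat_uh_def plus_fun_apply mat_ua_add uh_carrierD fps_glue_add)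

lemma mat_uh_0 [simp]: "mat_uh a b n 0 j d = 0"
  by (simp add: mat_uh_def zero_fun_apply)

lemma mat_uh_diff:
  assumes "u \<in> uh_carrier" "v \<in> uh_carrier"
  shows "mat_uh a b n (u - v) j d = mat_uh a b n u j d - mat_uh a b n v j d"
  using mat_uh_add[of "u - v" v] assms by (simp add: algebra_simps)

lemma mat_uh_const [simp]: "mat_uh a b n (uh_const u) j d = mat_ua a b n u j d"
  unfolding mat_uh_def by (subst fps_glue_decompose) (simp add: uh_const_def ua_zero_eq)

lemma mat_ua_scale:
  "mat_ua a b n (\<lambda>w. smult c (u w)) j d = fps_const c * mat_ua a b n u j d"
proof (cases "c = 0")
  case False
  then show ?thesis
    unfolding mat_ua_def sum_distrib_left
    by (intro sum.cong) (auto simp: mult.assoc simp flip: fps_const_mult)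
qed (simp add: mat_ua_def)

lemma mat_uh_smult:
  assumes "u \<in> uh_carrier"
  shows "mat_uh a b n (uh_smult c u) j d = c * mat_uh a b n u j d"
proof -
  have scale: "(\<lambda>w. smult c' (v w)) \<in> ua_carrier" if "v \<in> ua_carrier" for c' and v :: "'a ua"
    using that unfolding ua_carrier_def by (auto elim: rev_finite_subset)
  have "uh_smult c u m = (\<Sum>i\<le>m. (\<lambda>w. smult (fps_nth c i) (u (m - i) w)))" for m
    by (rule ext) (simp add: uh_smult_def sum_fun_apply)
  then have "mat_ua a b n (uh_smult c u m) j d =
      (\<Sum>i\<le>m. fps_const (fps_nth c i) * mat_ua a b n (u (m - i)) j d)" for m
    using assms by (simp add: mat_ua_sum scale uh_carrierD mat_ua_scale)
  moreover have "fps_glue (\<lambda>i. fps_const (fps_nth c i)) = c"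
  proof (rule fps_ext)
    fix m
    have "fps_nth (fps_glue (\<lambda>i. fps_const (fps_nth c i))) m = (\<Sum>i\<le>m. if i = m then fps_nth c i else 0)"
      unfolding fps_glue_def fps_nth_Abs_fps by (intro sum.cong) auto
    then show "fps_nth (fps_glue (\<lambda>i. fps_const (fps_nth c i))) m = fps_nth c m" by simp
  qed
  ultimately show ?thesis
    using fps_glue_mult[of "\<lambda>i. fps_const (fps_nth c i)" "\<lambda>i. mat_ua a b n (u i) j d"]
    by (simp add: mat_uh_def)
qed

lemma mat_uh_X: "mat_uh a b n (uh_smult fps_X u) j d = fps_X * mat_uh a b n u j d"
  unfolding mat_uh_def by (subst fps_glue_decompose) (simp add: uh_smult_X)

lemma mat_uh_decompose:
  "mat_uh a b n u j d = mat_ua a b n (u 0) j d + fps_X * mat_uh a b n (uh_shift u) j d"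
  unfolding mat_uh_def by (subst fps_glue_decompose) (simp add: uh_shift_def)

lemma mat_uh_mult:
  assumes u: "u \<in> uh_carrier" and v: "v \<in> uh_carrier"
    and hom: "\<And>i j d. d \<noteq> e \<Longrightarrow> mat_ua a b n (u i) j d = 0"
  shows "mat_uh a b n (uh_mult u v) j d =
    mat_uh a b n v j (d - e) * mat_uh a b n u (j - (d - e)) e"
proof -
  have "mat_ua a b n (uh_mult u v m) j d =
      (\<Sum>i\<le>m. mat_ua a b n (u i) (j - (d - e)) e * mat_ua a b n (v (m - i)) j (d - e))" for m
    using u v hom
    by (simp add: uh_mult_eq mat_ua_sum uh_carrierD mat_ua_mult[where e = e] mult.commute)
  then show ?thesis
    using fps_glue_mult[of "\<lambda>i. mat_ua a b n (u i) (j - (d - e)) e"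
        "\<lambda>i. mat_ua a b n (v i) j (d - e)"]
    by (simp add: mat_uh_def mult.commute)
qed

text \<open>Change of basis from b_k to (X-)^k b_0 = a(0) ... a(k-1) b_k. There X- has coefficient 1
  and X+ has coefficient \<open>b j * a (j - 1)\<close>. The products stand on both sides in place
  of a quotient.\<close>

lemma word_coeff_rescale:
  assumes b: "b 0 = 0" and b': "b' 0 = 0" "\<And>j. 1 \<le> j \<Longrightarrow> b' j = b j * a (j - 1)"
  shows "word_coeff a b w (int k) * (\<Prod>l<k. a (int l)) =
    word_coeff (\<lambda>_. 1) b' w (int k) * (\<Prod>l<nat (int k - wdeg w). a (int l))"
proof (induction w)
  case (Cons x w)
  \<comment> \<open>The index reached by w is negative, zero or positive. Below zero both
    coefficients vanish, and at zero X+ gives zero on both sides.\<close>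
  consider "int k < wdeg w" | "int k = wdeg w" | i where "int k - wdeg w = int (Suc i)"
    by (metis Suc_pred' diff_gt_0_iff_gt linorder_neqE zero_less_imp_eq_int)
  then show ?case
  proof cases
    case 1
    then show ?thesis using word_coeff_eq_0[of b "int k" w] word_coeff_eq_0[of b' "int k" w] b b' by simp
  next
    case 2
    then show ?thesis using Cons b b' by (simp add: mult_ac)
  next
    case 3
    then have "nat (int k - wdeg w) = Suc i" "nat (int k - (wdeg w + 1)) = i"
      "nat (int k - (wdeg w - 1)) = Suc (Suc i)" by auto
    then show ?thesis using Cons 3 b'(2)[of "int (Suc i)"] by (simp add: algebra_simps)
  qed
qed simp

lemma mat_uh_rescale:
  assumes "b 0 = 0" "b' 0 = 0" "\<And>j. 1 \<le> j \<Longrightarrow> b' j = b j * a (j - 1)"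
  shows "mat_uh a b n u (int k) (int k - int j) * (\<Prod>l<k. a (int l)) =
    mat_uh (\<lambda>_. 1) b' n u (int k) (int k - int j) * (\<Prod>l<j. a (int l))"
proof -
  have "mat_ua a b n v (int k) (int k - int j) * (\<Prod>l<k. a (int l)) =
    mat_ua (\<lambda>_. 1) b' n v (int k) (int k - int j) * (\<Prod>l<j. a (int l))" for v
    unfolding mat_ua_def sum_distrib_right
  proof (rule sum.cong[OF refl], goal_cases)
    case (1 w)
    show ?case
      using word_coeff_rescale[of b b' a w k, OF assms] by (auto simp: mult.assoc)
  qed
  then show ?thesis
    unfolding mat_uh_def by (simp add: mult.commute flip: fps_glue_cmult)
qed

section \<open>Normal ordering and Verma modules\<close>

lemma sl2_rel_eq: "sl2_rel = ua_mono [True, False] 1 - ua_mono [False, True] 1 - ua_mono [] [:0, 1:]"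
  by (simp add: sl2_rel_def ua_sub_eq ua_Xp_eq ua_Xm_eq ua_H_eq ua_mult_mono)

lemma sl2_rel_carrier [simp]: "sl2_rel \<in> ua_carrier"
  by (simp add: sl2_rel_eq)

section \<open>The ideal of U(a) defining U(sl2)\<close>

lemma sl2_ideal_0 [simp]: "0 \<in> sl2_ideal"
  using sl2_ideal.zero by (simp add: ua_zero_eq)

lemma sl2_ideal_add: "x \<in> sl2_ideal \<Longrightarrow> y \<in> sl2_ideal \<Longrightarrow> x + y \<in> sl2_ideal"
  using sl2_ideal.add by (simp add: ua_add_eq)

lemma sl2_ideal_carrier: "x \<in> sl2_ideal \<Longrightarrow> x \<in> ua_carrier"
  by (induction rule: sl2_ideal.induct) (simp_all add: ua_zero_eq ua_add_eq)

lemma sl2_ideal_uminus: "x \<in> sl2_ideal \<Longrightarrow> - x \<in> sl2_ideal"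
proof (induction rule: sl2_ideal.induct)
  case (add x y)
  then show ?case using sl2_ideal_add[of "- x" "- y"] by (simp add: ua_add_eq)
next
  case (gen a b)
  then have "ua_mult (ua_mult (- a) sl2_rel) b \<in> sl2_ideal" by (intro sl2_ideal.gen) auto
  then show ?case by (simp add: ua_mult_uminus_left)
qed (simp add: ua_zero_eq)

lemma sl2_ideal_diff: "x \<in> sl2_ideal \<Longrightarrow> y \<in> sl2_ideal \<Longrightarrow> x - y \<in> sl2_ideal"
  using sl2_ideal_add[of x "- y"] sl2_ideal_uminus[of y] by simp

lemma sl2_ideal_mult_left:
  assumes "x \<in> sl2_ideal" "u \<in> ua_carrier"
  shows "ua_mult u x \<in> sl2_ideal"
  using assms(1)
proof (induction rule: sl2_ideal.induct)
  case (gen a b)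
  then have "ua_mult (ua_mult (ua_mult u a) sl2_rel) b \<in> sl2_ideal"
    using assms(2) by (intro sl2_ideal.gen) auto
  with gen show ?case using assms(2) by (simp add: ua_mult_assoc)
qed (auto simp: ua_zero_eq ua_add_eq ua_mult_add_right intro: sl2_ideal_add)

section \<open>Reduction to the normal form (X-)^a (X+)^b p(H)\<close>

definition normal_word :: "bool list \<Rightarrow> bool" where
  "normal_word w \<longleftrightarrow> (\<exists>a b. w = replicate a False @ replicate b True)"

definition normally_ordered :: "'k::field_char_0 ua \<Rightarrow> bool" where
  "normally_ordered u \<longleftrightarrow> u \<in> ua_carrier \<and> (\<forall>w. u w \<noteq> 0 \<longrightarrow> normal_word w)"

definition reducible_to_normal :: "'k::field_char_0 ua \<Rightarrow> bool" where
  "reducible_to_normal u \<longleftrightarrow> u \<in> ua_carrier \<and> (\<exists>v. normally_ordered v \<and> u - v \<in> sl2_ideal)"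

lemma normally_ordered_add: "normally_ordered u \<Longrightarrow> normally_ordered v \<Longrightarrow> normally_ordered (u + v)"
  unfolding normally_ordered_def
  by (metis add_0 plus_fun_apply ua_carrier_add)

lemma normally_ordered_mono: "normal_word w \<Longrightarrow> normally_ordered (ua_mono w p)"
  unfolding normally_ordered_def using ua_mono_carrier[of w p] by (metis ua_mono_def)

lemma normally_ordered_imp_reducible: "normally_ordered u \<Longrightarrow> reducible_to_normal u"
  unfolding reducible_to_normal_def by (metis diff_self sl2_ideal_0 normally_ordered_def)

lemma reducible_to_normal_0: "reducible_to_normal 0"
  by (rule normally_ordered_imp_reducible) (simp add: normally_ordered_def zero_fun_apply)

lemma reducible_to_normal_add:
  assumes "reducible_to_normal u" "reducible_to_normal v"
  shows "reducible_to_normal (u + v)"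
proof -
  obtain x y where "normally_ordered x" "u - x \<in> sl2_ideal" "normally_ordered y" "v - y \<in> sl2_ideal"
    using assms unfolding reducible_to_normal_def by blast
  moreover from this have "(u + v) - (x + y) \<in> sl2_ideal"
    using sl2_ideal_add[of "u - x" "v - y"] by (simp add: algebra_simps)
  ultimately show ?thesis
    using assms normally_ordered_add unfolding reducible_to_normal_def by auto
qed

lemma reducible_to_normal_cong:
  assumes "u \<in> ua_carrier" "u - v \<in> sl2_ideal" "reducible_to_normal v"
  shows "reducible_to_normal u"
proof -
  obtain x where "normally_ordered x" "v - x \<in> sl2_ideal"
    using assms unfolding reducible_to_normal_def by blast
  moreover from this have "u - x \<in> sl2_ideal"
    using sl2_ideal_add[of "u - v" "v - x"] assms by simp
  ultimately show ?thesis using assms unfolding reducible_to_normal_def by auto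
qed

lemma normally_ordered_induct [consumes 1, case_names zero mono add]:
  assumes "normally_ordered u" and zero: "P 0"
    and mono: "\<And>w p. normal_word w \<Longrightarrow> P (ua_mono w p)"
    and add: "\<And>u v. P u \<Longrightarrow> P v \<Longrightarrow> P (u + v)"
  shows "P u"
proof -
  \<comment> \<open>Cutting an element down to its normal words is additive, so the induction can
    run over all of \<open>ua_carrier\<close> for the statement \<open>P (r u)\<close>.\<close>
  define r :: "'a ua \<Rightarrow> 'a ua" where "r = (\<lambda>u w. if normal_word w then u w else 0)"
  have r_add: "r (u + v) = r u + r v" for u v by (auto simp: r_def plus_fun_apply)
  have r_mono: "r (ua_mono w p) = (if normal_word w then ua_mono w p else 0)" for w p
    by (auto simp: r_def ua_mono_def fun_eq_iff zero_fun_apply)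
  have r_0: "r 0 = 0" by (simp add: r_def fun_eq_iff zero_fun_apply)
  have "u \<in> ua_carrier" using assms(1) by (simp add: normally_ordered_def)
  then have "P (r u)"
    by (induction rule: ua_carrier_induct) (auto simp: r_add r_mono r_0 zero mono add)
  moreover have "r u = u" using assms(1) by (auto simp: r_def normally_ordered_def fun_eq_iff)
  ultimately show ?thesis by simp
qed

text \<open>Since the ideal is stable under left multiplication, u can be replaced by its normal
  form, and then only normal monomials have to be treated.\<close>

lemma reducible_to_normal_mult:
  assumes x: "x \<in> ua_carrier"
    and norm: "\<And>w p. normal_word w \<Longrightarrow> reducible_to_normal (ua_mult x (ua_mono w p))"
    and u: "reducible_to_normal u"
  shows "reducible_to_normal (ua_mult x u)"
proof -
  obtain v where v: "normally_ordered v" "u - v \<in> sl2_ideal"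
    using u unfolding reducible_to_normal_def by blast
  have "reducible_to_normal (ua_mult x v)"
    using v(1)
    by (induction rule: normally_ordered_induct)
      (auto simp: norm ua_mult_add_right reducible_to_normal_add reducible_to_normal_0)
  moreover have "ua_mult x u - ua_mult x v \<in> sl2_ideal"
    using sl2_ideal_mult_left[OF v(2) x] by (simp add: ua_mult_diff_right)
  moreover have "ua_mult x u \<in> ua_carrier"
    using u x by (simp add: reducible_to_normal_def)
  ultimately show ?thesis using reducible_to_normal_cong by blast
qed

lemma reducible_to_normal_Xm:
  assumes "reducible_to_normal u"
  shows "reducible_to_normal (ua_mult (ua_mono [False] 1) u)"
proof (rule reducible_to_normal_mult[OF _ _ assms])
  fix w :: "bool list" and p :: "'a poly"
  assume "normal_word w"
  then have "normal_word (False # w)"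
    unfolding normal_word_def by (metis append_Cons replicate_Suc)
  then show "reducible_to_normal (ua_mult (ua_mono [False] 1) (ua_mono w p))"
    by (simp add: ua_mult_mono normally_ordered_mono normally_ordered_imp_reducible)
qed auto

text \<open>X+ X- (X-)^a (X+)^b p = X- X+ (X-)^a (X+)^b p + H (X-)^a (X+)^b p modulo the ideal.\<close>
lemma reducible_to_normal_mono_True:
  "reducible_to_normal (ua_mono (True # replicate a False @ replicate b True) p)"
proof (induction a arbitrary: p)
  case 0
  have "normal_word (True # replicate b True)"
    unfolding normal_word_def by (rule exI[of _ 0], rule exI[of _ "Suc b"]) simp
  then show ?case by (simp add: normally_ordered_mono normally_ordered_imp_reducible)
next
  case (Suc a)
  let ?w = "replicate a False @ replicate b True"
  \<comment> \<open>H to the left of \<open>?w\<close> becomes H + wt \<open>?w\<close> to its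
    right.\<close>
  let ?q = "[:of_int (wt ?w), 1:] * p"
  have "ua_mult (ua_mult (ua_mono [] 1) sl2_rel) (ua_mono ?w p) \<in> sl2_ideal"
    by (rule sl2_ideal.gen) auto
  then have "ua_mono (True # False # ?w) p - (ua_mono (False # True # ?w) p + ua_mono ?w ?q) \<in> sl2_ideal"
    by (simp add: sl2_rel_eq ua_mult_diff_left ua_mult_diff_right ua_mult_mono pcompose_pCons
        diff_diff_add ua_mult_add_left ua_mult_add_right)
  moreover have "reducible_to_normal (ua_mono (False # True # ?w) p)"
    using reducible_to_normal_Xm[OF Suc] by (simp add: ua_mult_mono)
  moreover have "reducible_to_normal (ua_mono ?w ?q)"
    by (intro normally_ordered_imp_reducible normally_ordered_mono) (auto simp: normal_word_def)
  ultimately show ?case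
    by (simp add: reducible_to_normal_cong reducible_to_normal_add)
qed

lemma reducible_to_normal_Xp:
  assumes "reducible_to_normal u"
  shows "reducible_to_normal (ua_mult (ua_mono [True] 1) u)"
  by (rule reducible_to_normal_mult[OF _ _ assms])
    (auto simp: normal_word_def ua_mult_mono reducible_to_normal_mono_True)

text \<open>The spanning half of the PBW theorem for U(sl2). A word is built up from its right end,
  and reordering is restored after each prefixed letter.\<close>

lemma reducible_to_normal: "u \<in> ua_carrier \<Longrightarrow> reducible_to_normal u"
proof (induction rule: ua_carrier_induct)
  case zero
  show ?case by (rule reducible_to_normal_0)
next
  case (mono w p)
  show ?case
  proof (induction w)
    case Nil
    show ?case
      by (intro normally_ordered_imp_reducible normally_ordered_mono)
        (auto simp: normal_word_def intro: exI[of _ 0])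
  next
    case (Cons x w)
    then show ?case using reducible_to_normal_Xp[OF Cons] reducible_to_normal_Xm[OF Cons]
      by (cases x) (simp_all add: ua_mult_mono)
  qed
qed (rule reducible_to_normal_add)

section \<open>Verma modules and the faithfulness of the action of U(sl2)\<close>

text \<open>The Verma module M(n) is the part j >= 0 of this sl2-module. Letting j range over all integers
makes the matrix coefficients polynomial in j and n without case distinctions.\<close>

definition verma_up :: "int \<Rightarrow> int \<Rightarrow> 'k::field_char_0 fps" where
  "verma_up n j = fps_const (of_int (j * (n - j + 1)))"

abbreviation verma_ua :: "int \<Rightarrow> 'k::field_char_0 ua \<Rightarrow> int \<Rightarrow> int \<Rightarrow> 'k fps" where
  "verma_ua n \<equiv> mat_ua (\<lambda>_. 1) (verma_up n) n"

abbreviation verma_uh :: "int \<Rightarrow> 'k::field_char_0 uha \<Rightarrow> int \<Rightarrow> int \<Rightarrow> 'k fps" where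
  "verma_uh n \<equiv> mat_uh (\<lambda>_. 1) (verma_up n) n"

text \<open>The relation X+ X- - X- X+ = H holds on v_j because (j+1)(n-j) - j(n-j+1) = n - 2j. The
  rest follows since elements acting by zero form a two-sided ideal.\<close>

lemma verma_ua_sl2_ideal:
  assumes "x \<in> sl2_ideal"
  shows "verma_ua n x j d = 0"
  using assms
proof (induction rule: sl2_ideal.induct)
  case (gen a b)
  have "verma_ua n sl2_rel j d = (0 :: 'a fps)" for j d
  proof -
    have "(j + 1) * (n - (j + 1) + 1) - j * (n - j + 1) = n - 2 * j" by (simp add: algebra_simps)
    then have "fps_const (of_int ((j + 1) * (n - (j + 1) + 1))) - fps_const (of_int (j * (n - j + 1)))
        = (fps_const (of_int (n - 2 * j)) :: 'a fps)"
      by (simp only: fps_const_sub flip: of_int_diff)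
    then show ?thesis
      by (simp add: sl2_rel_eq mat_ua_diff mat_ua_mono verma_up_def
         del: of_int_mult of_int_diff of_int_add fps_const_sub)
  qed
  then have "verma_ua n (ua_mult a sl2_rel) j d = 0" for j d
    using gen by (intro mat_ua_mult_eq_0) auto
  with gen show ?case by (intro mat_ua_mult_eq_0) auto
qed (auto simp: ua_zero_eq ua_add_eq mat_ua_add sl2_ideal_carrier)

lemma word_coeff_replicate_False [simp]: "word_coeff (\<lambda>_. 1) b (replicate i False) j = 1"
  by (induction i) auto

lemma wdeg_replicate [simp]: "wdeg (replicate i x) = (if x then int i else - int i)"
  by (induction i) auto

lemma word_coeff_replicate_True: "word_coeff a b (replicate i True) j = (\<Prod>l<i. b (j - int l))"
  by (induction i) auto

lemma verma_up_0 [simp]: "verma_up n 0 = 0"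
  by (simp add: verma_up_def)

lemma fps_const_prod: "fps_const (\<Prod>i\<in>I. f i) = (\<Prod>i\<in>I. fps_const (f i :: 'k::field))"
  by (induction I rule: infinite_finite_induct) (simp_all flip: fps_const_mult)

text \<open>Let b be the least power of X+ occurring in v, and apply v to the vector of index b.
  Words with more X+ kill it, and the words (X-)^a (X+)^b land on different vectors for different a.
  Thus the polynomial at such a word vanishes at infinitely many weights.\<close>

lemma normally_ordered_faithful:
  fixes v :: "'k::field_char_0 ua"
  assumes v: "normally_ordered v"
    and zero: "\<And>n j d. 0 \<le> j \<Longrightarrow> fps_nth (verma_ua n v j d) 0 = 0"
  shows "v = 0"
proof (rule ccontr)
  let ?N = "\<lambda>a b. replicate a False @ replicate b True"
  assume "v \<noteq> 0"
  then obtain w where "v w \<noteq> 0" by (auto simp: fun_eq_iff zero_fun_apply)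
  with v have ex: "\<exists>b a. v (?N a b) \<noteq> 0" unfolding normally_ordered_def normal_word_def by metis
  define b where "b = (LEAST b. \<exists>a. v (?N a b) \<noteq> 0)"
  obtain a where a: "v (?N a b) \<noteq> 0" using LeastI_ex[OF ex] unfolding b_def by blast
  have min: "b \<le> b'" if "v (?N a' b') \<noteq> 0" for a' b'
    unfolding b_def using that by (intro Least_le) blast
  define c where "c n = (\<Prod>l<b. of_int ((int b - int l) * (n - (int b - int l) + 1)) :: 'k)" for n
  have wc: "word_coeff (\<lambda>_. 1) (verma_up n) (?N a b) (int b) = fps_const (c n)" for n
    unfolding word_coeff_append word_coeff_replicate_True verma_up_def c_def
    by (simp add: fps_const_prod)
  have eq: "poly (v (?N a b)) (of_int (n - 2 * int b)) * c n = 0" for n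
  proof -
    have "verma_ua n v (int b) (int b - int a) = (\<Sum>w\<in>{w. v w \<noteq> 0}. if w = ?N a b then
        fps_const (poly (v w) (of_int (n - 2 * int b))) * fps_const (c n) else 0)"
      unfolding mat_ua_def
    proof (rule sum.cong[OF refl])
      fix w assume "w \<in> {w. v w \<noteq> 0}"
      then obtain a' b' where w: "w = ?N a' b'" "v (?N a' b') \<noteq> 0"
        using v unfolding normally_ordered_def normal_word_def by auto
      show "(if wdeg w = int b - int a then fps_const (poly (v w) (of_int (n - 2 * int b))) *
            word_coeff (\<lambda>_. 1) (verma_up n) w (int b) else 0) =
          (if w = ?N a b then fps_const (poly (v w) (of_int (n - 2 * int b))) * fps_const (c n) else 0)"
      proof (cases "b' = b")
        case True
        then show ?thesis
          unfolding w(1) using wc[of n] by (auto simp del: of_int_diff)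
      next
        case False
        with min[OF w(2)] have "b < b'" by simp
        then have "word_coeff (\<lambda>_. 1) (verma_up n) w (int b) = (0 :: 'k fps)"
          unfolding w(1) word_coeff_append by (simp add: word_coeff_eq_0)
        moreover have "w \<noteq> ?N a b"
        proof
          assume "w = ?N a b"
          then have "length (filter (\<lambda>x. x) w) = b" by simp
          moreover have "length (filter (\<lambda>x. x) w) = b'" using w(1) by simp
          ultimately show False using False by simp
        qed
        ultimately show ?thesis by simp
      qed
    qed
    also have "\<dots> = fps_const (poly (v (?N a b)) (of_int (n - 2 * int b))) * fps_const (c n)"
      using a v by (simp add: normally_ordered_def ua_carrier_def)
    finally show ?thesis using zero[of "int b" n "int b - int a"] by simp
  qed
  \<comment> \<open>For n >= b all factors of \<open>c n\<close> are positive integers, so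
    \<open>c n\<close> can be cancelled.\<close>
  have c: "c n \<noteq> 0" if "n \<ge> int b" for n
    unfolding c_def using that by (auto simp del: of_int_mult of_int_diff of_int_add)
  have "poly (v (?N a b)) (of_nat i - of_nat b) = 0" for i :: nat
    using eq[of "int i + int b"] c[of "int i + int b"] by (simp add: algebra_simps)
  then have "range (\<lambda>i. of_nat i - of_nat b) \<subseteq> {x. poly (v (?N a b)) x = 0}" by auto
  moreover have "infinite (range (\<lambda>i. of_nat i - of_nat b :: 'k))"
    by (rule range_inj_infinite) (auto simp: inj_def)
  ultimately show False using a poly_roots_finite finite_subset by blast
qed

lemma verma_ua_faithful:
  assumes u: "u \<in> ua_carrier"
    and zero: "\<And>n j d. 0 \<le> j \<Longrightarrow> fps_nth (verma_ua n u j d) 0 = 0"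
  shows "u \<in> sl2_ideal"
proof -
  obtain v where v: "normally_ordered v" "u - v \<in> sl2_ideal"
    using reducible_to_normal[OF u] unfolding reducible_to_normal_def by blast
  have "verma_ua n v j d = verma_ua n u j d" for n j d
    using verma_ua_sl2_ideal[OF v(2), of n j d] u v(1) by (simp add: mat_ua_diff normally_ordered_def)
  with zero normally_ordered_faithful[OF v(1)] have "v = 0" by simp
  with v show ?thesis by simp
qed

text \<open>Both indices carry the weight -n-2-2k, and (n+1+k)(-k) = k(-n-1-k) matches the
  coefficients of X+. For n >= 0 this is the inclusion of M(-n-2) into M(n).\<close>

lemma verma_ua_reflect: "verma_ua n u (n + 1 + k) d = verma_ua (- n - 2) u k d"
proof -
  have up: "verma_up n (n + 1 + k - i) = verma_up (- n - 2) (k - i)" for i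
    by (simp add: verma_up_def algebra_simps)
  have coeff: "word_coeff (\<lambda>_. 1) (verma_up n) w (n + 1 + k) = word_coeff (\<lambda>_. 1) (verma_up (- n - 2)) w k" for w
    by (induction w) (auto simp: up)
  have weight: "n - 2 * (n + 1 + k) = - n - 2 - 2 * k" by simp
  show ?thesis unfolding mat_ua_def coeff weight ..
qed

lemma verma_uh_reflect: "verma_uh n u (n + 1 + k) d = verma_uh (- n - 2) u k d"
  by (simp add: mat_uh_def verma_ua_reflect)

lemma verma_ua_constant: "verma_ua n u j d = fps_const (fps_nth (verma_ua n u j d) 0)"
proof -
  have coeff: "\<exists>c. word_coeff (\<lambda>_. 1) (verma_up n) w j = (fps_const c :: 'a fps)" for w
    by (induction w) (auto simp: verma_up_def simp flip: fps_const_1_eq_1)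
  have "\<exists>c. (\<Sum>w\<in>S. if wdeg w = d then fps_const (poly (u w) (of_int (n - 2 * j))) *
      word_coeff (\<lambda>_. 1) (verma_up n) w j else 0) = fps_const c" for S
  proof (induction S rule: infinite_finite_induct)
    case (insert w S)
    obtain c where c: "word_coeff (\<lambda>_. 1) (verma_up n) w j = (fps_const c :: 'a fps)" using coeff by blast
    obtain c' where c': "(\<Sum>w\<in>S. if wdeg w = d then fps_const (poly (u w) (of_int (n - 2 * j))) *
      word_coeff (\<lambda>_. 1) (verma_up n) w j else 0) = fps_const c'" using insert.IH by blast
    show ?case
      unfolding sum.insert[OF insert.hyps] c c'
      by (rule exI[of _ "(if wdeg w = d then poly (u w) (of_int (n - 2 * j)) * c else 0) + c'"]) simp
  qed (auto simp flip: fps_const_0_eq_0)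
  then have "\<exists>c. verma_ua n u j d = fps_const c" unfolding mat_ua_def .
  then show ?thesis by auto
qed

text \<open>The structure constants of M(n) are free of h, so the coefficients of a series act
  separately and the action of each \<open>u m\<close> can be read off.\<close>

lemma verma_uh_nth: "fps_nth (verma_uh n u j d) m = fps_nth (verma_ua n (u m) j d) 0"
proof -
  have "fps_nth (verma_uh n u j d) m =
      (\<Sum>i\<le>m. fps_nth (fps_const (fps_nth (verma_ua n (u i) j d) 0)) (m - i))"
    unfolding mat_uh_def fps_glue_def by (simp flip: verma_ua_constant)
  also have "\<dots> = (\<Sum>i\<le>m. if i = m then fps_nth (verma_ua n (u i) j d) 0 else 0)"
    by (intro sum.cong) auto
  finally show ?thesis by simp
qed

lemma verma_uh_eq_0D: "verma_uh n u j d = 0 \<Longrightarrow> verma_ua n (u m) j d = 0"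
  by (metis verma_ua_constant verma_uh_nth fps_zero_nth fps_const_0_eq_0)

text \<open>The factor v need only act as p(H) does, because a lift of an element of A is determined
  only modulo the ideal. Here u is arbitrary, while v multiplies each basis vector by a
  scalar.\<close>

lemma verma_uh_mult_const:
  assumes "u \<in> uh_carrier" "v \<in> uh_carrier"
    and v: "\<And>i j d. verma_ua n (v i) j d = verma_ua n (uh_const (ua_mono [] p) i) j d"
  shows "verma_uh n (uh_mult u v) j d = fps_const (poly p (of_int (n - 2 * j))) * verma_uh n u j d"
proof -
  have "verma_ua n (ua_mult (u i) (v l)) j d =
      (if l = 0 then fps_const (poly p (of_int (n - 2 * j))) * verma_ua n (u i) j d else 0)" for i l
  proof -
    let ?c = "uh_const (ua_mono [] p)"
    have c: "?c l \<in> ua_carrier" by (auto simp: uh_const_def ua_zero_eq)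
    have "verma_ua n (ua_mult (u i) (v l - ?c l)) j d = 0"
      using assms c by (intro mat_ua_mult_eq_0) (auto simp: uh_carrierD mat_ua_diff)
    then have "verma_ua n (ua_mult (u i) (v l)) j d = verma_ua n (ua_mult (u i) (?c l)) j d"
      using assms c by (simp add: ua_mult_diff_right mat_ua_diff uh_carrierD)
    then show ?thesis
      using assms(1) by (auto simp: uh_const_def ua_zero_eq mat_ua_mult_mono uh_carrierD mat_ua_mono)
  qed
  then have "verma_ua n (uh_mult u v m) j d =
      (\<Sum>i\<le>m. if i = m then fps_const (poly p (of_int (n - 2 * j))) * verma_ua n (u i) j d else 0)" for m
    using assms unfolding uh_mult_eq
    by (subst mat_ua_sum) (auto simp: uh_carrierD intro!: sum.cong)
  then show ?thesis by (simp add: mat_uh_def fps_glue_cmult)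
qed

lemma mat_ua_eq_0:
  assumes "b 0 = 0" "0 \<le> j" "j < d"
  shows "mat_ua a b n u j d = 0"
  unfolding mat_ua_def using word_coeff_eq_0[of b j _ a] assms by (intro sum.neutral) auto

lemma mat_uh_eq_0:
  assumes "b 0 = 0" "0 \<le> j" "j < d"
  shows "mat_uh a b n u j d = 0"
  by (simp add: mat_uh_def mat_ua_eq_0[of b, OF assms])

section \<open>Colourings and polynomiality\<close>

text \<open>The coefficients of X+ on V_h(n,psi), extended by zero to all j <= 0. The value at 0
  expresses that X+ kills b_0.\<close>

definition colour_up :: "(nat \<Rightarrow> int \<Rightarrow> 'k::field_char_0 fps) \<Rightarrow> int \<Rightarrow> int \<Rightarrow> 'k fps" where
  "colour_up psi n j = (if 1 \<le> j then psi (nat j) n else 0)"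

lemma colour_up_0 [simp]: "colour_up psi n 0 = 0"
  by (simp add: colour_up_def)

abbreviation colour_uh ::
  "(nat \<Rightarrow> int \<Rightarrow> 'k::field_char_0 fps) \<Rightarrow> int \<Rightarrow> 'k uha \<Rightarrow> int \<Rightarrow> int \<Rightarrow> 'k fps" where
  "colour_uh psi n \<equiv> mat_uh (\<lambda>_. 1) (colour_up psi n) n"

text \<open>When X+ meets b_0, \<open>wact\<close> continues from the default (0, 0), so its index
  is claimed only for a nonzero coefficient.\<close>

lemma wact_word_coeff:
  "fst (wact psi n w k) = word_coeff (\<lambda>_. 1) (colour_up psi n) w (int k) \<and>
   (fst (wact psi n w k) \<noteq> 0 \<longrightarrow> int (snd (wact psi n w k)) = int k - wdeg w)"
proof (induction w)
  case (Cons x w)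
  obtain c j where cj: "wact psi n w k = (c, j)" by fastforce
  show ?case
  proof (cases "c = 0")
    case False
    with Cons cj have j: "int k - wdeg w = int j" by simp
    show ?thesis
    proof (cases "j = 0")
      case True
      with Cons cj j show ?thesis by auto
    next
      case False
      with j have "colour_up psi n (int k - wdeg w) = psi j n" by (simp add: colour_up_def)
      with Cons cj j False show ?thesis by auto
    qed
  qed (use Cons cj in auto)
qed simp

lemma vh_act_eq:
  "vh_act psi n u v m j = (\<Sum>b\<le>m. \<Sum>k\<in>{k. v b k \<noteq> 0}.
     v b k * fps_nth (colour_uh psi n u (int k) (int k - int j)) (m - b))"
proof -
  define f where "f a b = (\<Sum>k\<in>{k. v b k \<noteq> 0}. \<Sum>w\<in>{w. u a w \<noteq> 0}.
      (if snd (wact psi n w k) = j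
       then v b k * poly (u a w) (of_int n - 2 * of_nat k) * fps_nth (fst (wact psi n w k)) (m - a - b)
       else 0))" for a b
  have f: "f a b = (\<Sum>k\<in>{k. v b k \<noteq> 0}. v b k *
      fps_nth (mat_ua (\<lambda>_. 1) (colour_up psi n) n (u a) (int k) (int k - int j)) (m - b - a))" for a b
    unfolding f_def mat_ua_def fps_sum_nth sum_distrib_left
  proof (intro sum.cong refl, goal_cases)
    case (1 k w)
    show ?case
    proof (cases "fst (wact psi n w k) = 0")
      case True
      then show ?thesis using wact_word_coeff[of psi n w k] by simp
    next
      case False
      then have "snd (wact psi n w k) = j \<longleftrightarrow> wdeg w = int k - int j"
        using wact_word_coeff[of psi n w k] by linarith
      then show ?thesis
        using wact_word_coeff[of psi n w k] by (simp add: add.commute[of a b])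
    qed
  qed
  \<comment> \<open>Interchanging the summations over a + b <= m turns the inner sum over a into a
    coefficient of \<open>fps_glue\<close>.\<close>
  have "vh_act psi n u v m j = (\<Sum>a\<le>m. \<Sum>b\<le>m - a. f a b)"
    by (simp add: vh_act_def f_def)
  also have "\<dots> = (\<Sum>(a, b)\<in>{(a, b). a + b \<le> m}. f a b)"
    by (subst sum.Sigma) (auto intro!: sum.cong)
  also have "\<dots> = (\<Sum>(b, a)\<in>{(b, a). b + a \<le> m}. f a b)"
    by (rule sum.reindex_bij_witness[of _ prod.swap prod.swap]) auto
  also have "\<dots> = (\<Sum>b\<le>m. \<Sum>a\<le>m - b. f a b)"
    by (subst sum.Sigma) (auto intro!: sum.cong)
  also have "\<dots> = (\<Sum>b\<le>m. \<Sum>k\<in>{k. v b k \<noteq> 0}.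
     v b k * fps_nth (colour_uh psi n u (int k) (int k - int j)) (m - b))"
  proof (rule sum.cong[OF refl])
    fix b
    show "(\<Sum>a\<le>m - b. f a b) = (\<Sum>k\<in>{k. v b k \<noteq> 0}.
        v b k * fps_nth (colour_uh psi n u (int k) (int k - int j)) (m - b))"
      unfolding f by (subst sum.swap) (simp add: mat_uh_def fps_glue_def sum_distrib_left)
  qed
  finally show ?thesis .
qed

lemma ann_ideal_iff:
  "u \<in> ann_ideal psi \<longleftrightarrow>
     u \<in> uh_carrier \<and> (\<forall>n k j. colour_uh psi n u (int k) (int k - int j) = 0)"
proof (intro iffI conjI allI)
  fix n :: int and k j :: nat
  assume u: "u \<in> ann_ideal psi"
  \<comment> \<open>The basis vector b_k, which isolates a single column of the action.\<close>
  let ?v = "\<lambda>m i. if m = (0::nat) \<and> i = k then 1 else (0 :: 'a)"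
  have "?v \<in> vh_carrier" by (simp add: vh_carrier_def)
  with u have zero: "vh_act psi n u ?v m j = 0" for m by (simp add: ann_ideal_def)
  show "colour_uh psi n u (int k) (int k - int j) = 0"
  proof (rule fps_ext)
    fix m
    have "vh_act psi n u ?v m j =
        (\<Sum>b\<le>m. if b = 0 then fps_nth (colour_uh psi n u (int k) (int k - int j)) m else 0)"
      unfolding vh_act_eq by (intro sum.cong) auto
    with zero[of m] show "fps_nth (colour_uh psi n u (int k) (int k - int j)) m = fps_nth 0 m"
      by simp
  qed
qed (auto simp: ann_ideal_def vh_act_eq fun_eq_iff)

section \<open>Functions whose h-coefficients are polynomial in j and n\<close>

definition polynomial_fun :: "(int \<Rightarrow> int \<Rightarrow> 'k::field_char_0) \<Rightarrow> bool" where
  "polynomial_fun f \<longleftrightarrow> (\<exists>P. \<forall>j n. f j n = eval2 P (of_int j) (of_int n))"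

lemma polynomial_fun_const: "polynomial_fun (\<lambda>j n. c)"
  unfolding polynomial_fun_def eval2_def by (rule exI[of _ "[:[:c:]:]"]) simp

lemma polynomial_fun_fst: "polynomial_fun (\<lambda>j n. of_int j)"
  unfolding polynomial_fun_def eval2_def by (rule exI[of _ "[:0, 1:]"]) simp

lemma polynomial_fun_snd: "polynomial_fun (\<lambda>j n. of_int n)"
  unfolding polynomial_fun_def eval2_def by (rule exI[of _ "[:[:0, 1:]:]"]) simp

lemma polynomial_fun_add:
  assumes "polynomial_fun f" "polynomial_fun g"
  shows "polynomial_fun (\<lambda>j n. f j n + g j n)"
proof -
  obtain P Q where "\<forall>j n. f j n = eval2 P (of_int j) (of_int n)"
    "\<forall>j n. g j n = eval2 Q (of_int j) (of_int n)"
    using assms unfolding polynomial_fun_def by blast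
  then show ?thesis unfolding polynomial_fun_def
    by (intro exI[of _ "P + Q"]) (simp add: eval2_def)
qed

lemma polynomial_fun_mult:
  assumes "polynomial_fun f" "polynomial_fun g"
  shows "polynomial_fun (\<lambda>j n. f j n * g j n)"
proof -
  obtain P Q where "\<forall>j n. f j n = eval2 P (of_int j) (of_int n)"
    "\<forall>j n. g j n = eval2 Q (of_int j) (of_int n)"
    using assms unfolding polynomial_fun_def by blast
  then show ?thesis unfolding polynomial_fun_def
    by (intro exI[of _ "P * Q"]) (simp add: eval2_def)
qed

lemma polynomial_fun_sum:
  assumes "\<And>i. i \<in> I \<Longrightarrow> polynomial_fun (f i)"
  shows "polynomial_fun (\<lambda>j n. \<Sum>i\<in>I. f i j n)"
  using assms
proof (induction I rule: infinite_finite_induct)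
  case (insert i I)
  have "polynomial_fun (\<lambda>j n. f i j n + (\<Sum>i\<in>I. f i j n))"
    using insert by (intro polynomial_fun_add) auto
  with insert.hyps show ?case by simp
qed (simp_all add: polynomial_fun_const)

lemma polynomial_fun_poly:
  assumes "polynomial_fun f"
  shows "polynomial_fun (\<lambda>j n. poly p (f j n))"
  by (induction p) (simp_all add: polynomial_fun_const polynomial_fun_add polynomial_fun_mult assms)

lemma polynomial_fun_shift:
  assumes "polynomial_fun f"
  shows "polynomial_fun (\<lambda>j n. f (j - 1) n)"
proof -
  obtain P where "\<forall>j n. f j n = eval2 P (of_int j) (of_int n)"
    using assms unfolding polynomial_fun_def by blast
  \<comment> \<open>In (k[y])[x] the polynomial \<open>[:[:-1:], 1:]\<close> is x - 1.\<close>
  then show ?thesis unfolding polynomial_fun_def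
    by (intro exI[of _ "pcompose P [:[:-1:], 1:]"]) (simp add: eval2_def poly_pcompose)
qed

definition polynomial_fps_fun :: "(int \<Rightarrow> int \<Rightarrow> 'k::field_char_0 fps) \<Rightarrow> bool" where
  "polynomial_fps_fun F \<longleftrightarrow> (\<forall>m. polynomial_fun (\<lambda>j n. fps_nth (F j n) m))"

lemma polynomial_fps_fun_const:
  assumes "polynomial_fun f"
  shows "polynomial_fps_fun (\<lambda>j n. fps_const (f j n))"
  unfolding polynomial_fps_fun_def
proof
  fix m
  show "polynomial_fun (\<lambda>j n. fps_nth (fps_const (f j n)) m)"
    using assms polynomial_fun_const[of 0] by (cases m) auto
qed

lemma polynomial_fps_fun_mult:
  assumes "polynomial_fps_fun F" "polynomial_fps_fun G"
  shows "polynomial_fps_fun (\<lambda>j n. F j n * G j n)"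
  unfolding polynomial_fps_fun_def fps_mult_nth
proof (intro allI polynomial_fun_sum)
  fix m i
  show "polynomial_fun (\<lambda>j n. fps_nth (F j n) i * fps_nth (G j n) (m - i))"
    using assms by (intro polynomial_fun_mult) (simp_all add: polynomial_fps_fun_def)
qed

lemma polynomial_fps_fun_sum:
  assumes "\<And>i. i \<in> I \<Longrightarrow> polynomial_fps_fun (F i)"
  shows "polynomial_fps_fun (\<lambda>j n. \<Sum>i\<in>I. F i j n)"
  unfolding polynomial_fps_fun_def fps_sum_nth
proof (intro allI polynomial_fun_sum)
  fix m i
  assume "i \<in> I"
  then show "polynomial_fun (\<lambda>j n. fps_nth (F i j n) m)"
    using assms by (simp add: polynomial_fps_fun_def)
qed

text \<open>For each word the coefficient is a product of polynomials in j and n, and the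
  coefficient of h^m involves only \<open>u 0\<close>, ..., \<open>u m\<close>.\<close>

lemma polynomial_fps_fun_verma_uh: "polynomial_fps_fun (\<lambda>j n. verma_uh n u j d)"
proof -
  have aff: "polynomial_fun (\<lambda>j n. of_int (x * j + y * n + z) :: 'a)" for x y z
    by (simp add: polynomial_fun_add polynomial_fun_mult polynomial_fun_const
        polynomial_fun_fst polynomial_fun_snd)
  have one: "polynomial_fps_fun (\<lambda>j n. 1 :: 'a fps)"
    using polynomial_fps_fun_const[OF polynomial_fun_const[of "1 :: 'a"]] by simp
  have zero: "polynomial_fps_fun (\<lambda>j n. 0 :: 'a fps)"
    using polynomial_fps_fun_const[OF polynomial_fun_const[of "0 :: 'a"]] by simp
  have up: "polynomial_fps_fun (\<lambda>j n. verma_up n (j - i) :: 'a fps)" for i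
    unfolding verma_up_def of_int_mult
    using aff[of 1 0 "- i"] aff[of "- 1" 1 "i + 1"]
    by (intro polynomial_fps_fun_const polynomial_fun_mult) (simp_all add: algebra_simps)
  have coeff: "polynomial_fps_fun (\<lambda>j n. word_coeff (\<lambda>_. 1) (verma_up n) w j :: 'a fps)" for w
  proof (induction w)
    case (Cons x w)
    then show ?case by (cases x) (simp_all add: polynomial_fps_fun_mult up)
  qed (simp add: one)
  have weight: "polynomial_fps_fun (\<lambda>j n. fps_const (poly p (of_int (n - 2 * j) :: 'a)))" for p
    using aff[of "- 2" 1 0] by (intro polynomial_fps_fun_const polynomial_fun_poly) simp
  have "polynomial_fps_fun (\<lambda>j n. verma_ua n (u m) j d)" for m
    unfolding mat_ua_def
  proof (rule polynomial_fps_fun_sum)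
    fix w
    show "polynomial_fps_fun (\<lambda>j n. if wdeg w = d then fps_const (poly (u m w) (of_int (n - 2 * j))) *
        word_coeff (\<lambda>_. 1) (verma_up n) w j else 0)"
      using polynomial_fps_fun_mult[OF weight coeff] zero by (cases "wdeg w = d") auto
  qed
  then show ?thesis
    unfolding polynomial_fps_fun_def mat_uh_def fps_glue_def fps_nth_Abs_fps
    by (intro allI polynomial_fun_sum) simp
qed

section \<open>Trivialized deformations\<close>

lemma sl2_cls_self: "u \<in> ua_carrier \<Longrightarrow> u \<in> sl2_cls u"
  by (simp add: sl2_cls_def ua_sub_eq)

lemma sl2_cls_rep: "u \<in> ua_carrier \<Longrightarrow> rep (sl2_cls u) \<in> sl2_cls u"
  unfolding rep_def using someI[of "\<lambda>x. x \<in> sl2_cls u"] sl2_cls_self by blast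

lemma sl2_cls_eqI:
  assumes "x - u \<in> sl2_ideal"
  shows "sl2_cls x = sl2_cls u"
proof -
  have "v - x \<in> sl2_ideal \<longleftrightarrow> v - u \<in> sl2_ideal" for v
    using sl2_ideal_add[of "v - x" "x - u"] sl2_ideal_diff[of "v - u" "x - u"] assms by auto
  then show ?thesis by (auto simp: sl2_cls_def ua_sub_eq)
qed

lemma Usl2_rep:
  assumes "C \<in> Usl2"
  shows "rep C \<in> ua_carrier" "sl2_cls (rep C) = C"
proof -
  obtain u where u: "u \<in> ua_carrier" "C = sl2_cls u" using assms by (auto simp: Usl2_def)
  then have "rep C \<in> sl2_cls u" using sl2_cls_rep by simp
  with u show "rep C \<in> ua_carrier" "sl2_cls (rep C) = C"
    using sl2_cls_eqI by (auto simp: sl2_cls_def ua_sub_eq)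
qed

lemma sl2_cls_Usl2: "u \<in> ua_carrier \<Longrightarrow> sl2_cls u \<in> Usl2"
  by (simp add: Usl2_def)

lemma verma_ua_rep_cls:
  assumes "u \<in> ua_carrier"
  shows "verma_ua n (rep (sl2_cls u)) j d = verma_ua n u j d"
proof -
  have "rep (sl2_cls u) \<in> ua_carrier" "rep (sl2_cls u) - u \<in> sl2_ideal"
    using sl2_cls_rep[OF assms] by (auto simp: sl2_cls_def ua_sub_eq)
  then show ?thesis using verma_ua_sl2_ideal[of "rep (sl2_cls u) - u" n j d] assms
    by (simp add: mat_ua_diff)
qed

text \<open>Fixes one trivialization g, through which A acts on the modules M(n)[[h]].\<close>

locale trivialized_deformation =
  fixes sm :: "'k::field_char_0 fps \<Rightarrow> 'a::ring_1 \<Rightarrow> 'a"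
    and rho :: "'k uha \<Rightarrow> 'a"
    and g :: "(nat \<Rightarrow> 'k ua set) \<Rightarrow> 'a"
  assumes struct: "Uh_structure sm rho"
    and g_bij: "bij_betw g usl2h_carrier UNIV"
    and g_one: "g (usl2h_const (sl2_cls ua_one)) = 1"
    and g_add: "s \<in> usl2h_carrier \<Longrightarrow> t \<in> usl2h_carrier \<Longrightarrow> g (usl2h_add s t) = g s + g t"
    and g_mult: "s \<in> usl2h_carrier \<Longrightarrow> t \<in> usl2h_carrier \<Longrightarrow> g (usl2h_mult s t) = g s * g t"
    and g_smult: "s \<in> usl2h_carrier \<Longrightarrow> g (usl2h_smult c s) = sm c (g s)"
    and g_H: "g (usl2h_const (sl2_cls ua_H)) = rho (uh_const ua_H)"
    and g_iso: "a_alg_iso_sl2 sm rho (\<lambda>C. modh sm (g (usl2h_const C)))"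
begin

lemma rho_add: "u \<in> uh_carrier \<Longrightarrow> v \<in> uh_carrier \<Longrightarrow> rho (u + v) = rho u + rho v"
  and rho_mult: "u \<in> uh_carrier \<Longrightarrow> v \<in> uh_carrier \<Longrightarrow> rho (uh_mult u v) = rho u * rho v"
  and rho_smult: "u \<in> uh_carrier \<Longrightarrow> rho (uh_smult c u) = sm c (rho u)"
  and rho_one: "rho uh_one = 1"
  and sm_add: "sm c (x + y) = sm c x + sm c y"
  using struct by (simp_all add: Uh_structure_def fps_algebra_def uh_add_eq)

lemma rho_0 [simp]: "rho 0 = 0"
  using rho_add[of 0 0] by simp

lemma rho_diff: "u \<in> uh_carrier \<Longrightarrow> v \<in> uh_carrier \<Longrightarrow> rho (u - v) = rho u - rho v"
  using rho_add[of "u - v" v] by (simp add: algebra_simps)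

lemma sm_0 [simp]: "sm c 0 = 0"
  using sm_add[of c 0 0] by simp

lemma sm_diff: "sm c (x - y) = sm c x - sm c y"
  using sm_add[of c "x - y" y] by (simp add: algebra_simps)

text \<open>Chooses a representative in U_h(a) of the preimage of a under g. The choice respects the
  operations only modulo \<open>sl2_ideal\<close>, which acts by zero on the Verma modules.\<close>

definition lift :: "'a \<Rightarrow> 'k uha" where
  "lift a = (\<lambda>m. rep (inv_into usl2h_carrier g a m))"

definition verma_coeff :: "int \<Rightarrow> 'a \<Rightarrow> int \<Rightarrow> int \<Rightarrow> 'k fps" where
  "verma_coeff n a j d = verma_uh n (lift a) j d"

lemma lift_props:
  shows "lift a \<in> uh_carrier" and "(\<lambda>m. sl2_cls (lift a m)) \<in> usl2h_carrier"
    and "g (\<lambda>m. sl2_cls (lift a m)) = a"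
proof -
  have s: "inv_into usl2h_carrier g a \<in> usl2h_carrier" "g (inv_into usl2h_carrier g a) = a"
    using g_bij inv_into_into[of a g usl2h_carrier] f_inv_into_f[of a g usl2h_carrier]
    by (simp_all add: bij_betw_def)
  then have "(\<lambda>m. sl2_cls (lift a m)) = inv_into usl2h_carrier g a"
    by (auto simp: lift_def usl2h_carrier_def Usl2_rep)
  with s show "(\<lambda>m. sl2_cls (lift a m)) \<in> usl2h_carrier" "g (\<lambda>m. sl2_cls (lift a m)) = a"
    by simp_all
  show "lift a \<in> uh_carrier"
    using s(1) by (intro uh_carrierI) (simp add: lift_def usl2h_carrier_def Usl2_rep)
qed

lemma lift_g: "s \<in> usl2h_carrier \<Longrightarrow> lift (g s) = (\<lambda>m. rep (s m))"
  using g_bij by (simp add: lift_def bij_betw_def)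

lemma lift_g_cls:
  assumes "u \<in> uh_carrier"
  shows "lift (g (\<lambda>m. sl2_cls (u m))) m = rep (sl2_cls (u m))"
  using assms by (subst lift_g) (auto simp: usl2h_carrier_def sl2_cls_Usl2 uh_carrierD)

lemma verma_coeff_g:
  assumes "u \<in> uh_carrier"
  shows "verma_coeff n (g (\<lambda>m. sl2_cls (u m))) j d = verma_uh n u j d"
  using assms by (simp add: verma_coeff_def mat_uh_def lift_g_cls verma_ua_rep_cls uh_carrierD)

text \<open>The operations on U(sl2)[[h]] are defined through \<open>rep\<close>. Since lifts
  consist of such representatives, these operations become literal ones on lifts.\<close>

lemma rep_lift:
  "rep (sl2_cls (lift a m)) = lift a m"
  using fun_cong[OF lift_g[OF lift_props(2), of a], of m] unfolding lift_props(3) by (rule sym)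

lemma add_eq_g: "a + b = g (\<lambda>m. sl2_cls ((lift a + lift b) m))"
  using g_add[OF lift_props(2) lift_props(2), of a b]
  by (simp add: lift_props(3) usl2h_add_def rep_lift ua_add_eq plus_fun_apply)

lemma verma_coeff_add: "verma_coeff n (a + b) j d = verma_coeff n a j d + verma_coeff n b j d"
  unfolding add_eq_g by (subst verma_coeff_g) (auto simp: lift_props(1) mat_uh_add verma_coeff_def)

lemma verma_coeff_diff: "verma_coeff n (a - b) j d = verma_coeff n a j d - verma_coeff n b j d"
  using verma_coeff_add[of n "a - b" b] by simp

lemma verma_coeff_sm: "verma_coeff n (sm c a) j d = c * verma_coeff n a j d"
proof -
  have "sm c a = g (\<lambda>m. sl2_cls (uh_smult c (lift a) m))"
    using g_smult[OF lift_props(2), of c a]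
    by (simp add: lift_props(3) usl2h_smult_def rep_lift uh_smult_def)
  then show ?thesis by (simp add: verma_coeff_g mat_uh_smult lift_props(1)) (simp add: verma_coeff_def)
qed

lemma verma_coeff_mult_eq: "verma_coeff n (a * b) j d = verma_uh n (uh_mult (lift a) (lift b)) j d"
proof -
  have "a * b = g (\<lambda>m. sl2_cls (uh_mult (lift a) (lift b) m))"
    using g_mult[OF lift_props(2) lift_props(2), of a b]
    by (simp add: lift_props(3) usl2h_mult_def rep_lift uh_mult_def)
  then show ?thesis by (simp add: verma_coeff_g lift_props(1))
qed

lemma verma_coeff_mult:
  assumes "\<And>j d. d \<noteq> e \<Longrightarrow> verma_coeff n a j d = 0"
  shows "verma_coeff n (a * b) j d = verma_coeff n b j (d - e) * verma_coeff n a (j - (d - e)) e"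
proof -
  have "verma_ua n (lift a i) j d = 0" if "d \<noteq> e" for i j d
    using assms[OF that] unfolding verma_coeff_def by (rule verma_uh_eq_0D)
  then show ?thesis
    unfolding verma_coeff_mult_eq unfolding verma_coeff_def using lift_props(1) by (intro mat_uh_mult)
qed

lemma usl2h_const_cls: "usl2h_const (sl2_cls u) = (\<lambda>m. sl2_cls (uh_const u m))"
  by (rule ext) (simp add: usl2h_const_def uh_const_def)

lemma rho_H: "rho (uh_const ua_H) = g (\<lambda>m. sl2_cls (uh_const ua_H m))"
  using g_H by (simp add: usl2h_const_cls)

lemma verma_coeff_g_const: "u \<in> ua_carrier \<Longrightarrow> verma_coeff n (g (usl2h_const (sl2_cls u))) j d = verma_ua n u j d"
  unfolding usl2h_const_cls by (subst verma_coeff_g) simp_all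

lemma verma_coeff_one: "verma_coeff n 1 j d = (if d = 0 then 1 else 0)"
  using verma_coeff_g_const[of ua_one n j d, unfolded g_one] by (auto simp: ua_one_eq mat_ua_mono)

lemma verma_coeff_H: "verma_coeff n (rho (uh_const ua_H)) j d = (if d = 0 then fps_const (of_int (n - 2 * j)) else 0)"
  using verma_coeff_g_const[of ua_H n j d, unfolded g_H] by (auto simp: ua_H_eq mat_ua_mono)

text \<open>Here a is not assumed homogeneous, so \<open>verma_coeff_mult\<close> does not apply.
  Instead g(H) = H shows that the lift of rho(H) acts as H does.\<close>

lemma verma_coeff_mult_H: "verma_coeff n (a * rho (uh_const ua_H)) j d = fps_const (of_int (n - 2 * j)) * verma_coeff n a j d"
proof -
  have "verma_ua n (lift (rho (uh_const ua_H)) i) j d = verma_ua n (uh_const (ua_mono [] [:0, 1:]) i) j d"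
    for i j d
    unfolding rho_H by (subst lift_g_cls) (auto simp: ua_H_eq verma_ua_rep_cls uh_carrierD)
  then show ?thesis
    unfolding verma_coeff_mult_eq by (subst verma_uh_mult_const[where p = "[:0, 1:]"]) (auto simp: lift_props(1) verma_coeff_def)
qed

lemma verma_coeff_faithful:
  assumes "\<And>n j d. 0 \<le> j \<Longrightarrow> verma_coeff n a j d = 0"
  shows "a = 0"
proof -
  have ideal: "lift a m \<in> sl2_ideal" for m
    using lift_props(1) assms
    by (intro verma_ua_faithful) (simp_all add: uh_carrierD verma_coeff_def verma_uh_eq_0D)
  then have cls: "sl2_cls (lift a m) = sl2_cls 0" for m
    by (intro sl2_cls_eqI) simp
  \<comment> \<open>As all coefficients of the lift lie in the ideal, a and a + a are both the image
    under g of the zero series, whence a + a = a.\<close>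
  have "(lift a + lift a) m - 0 \<in> sl2_ideal" for m
    using sl2_ideal_add[OF ideal ideal] unfolding plus_fun_apply diff_0_right .
  then have "a + a = g (\<lambda>m. sl2_cls 0)"
    unfolding add_eq_g using sl2_cls_eqI by metis
  also have "\<dots> = a" using lift_props(3)[of a] by (simp add: cls)
  finally show ?thesis by simp
qed

lemma verma_coeff_reflect: "verma_coeff n a (n + 1 + k) d = verma_coeff (- n - 2) a k d"
  by (simp add: verma_coeff_def verma_uh_reflect)

section \<open>The structure map in terms of the coefficients of X- and X+\<close>

definition down :: "int \<Rightarrow> int \<Rightarrow> 'k fps" where
  "down n j = verma_coeff n (rho (uh_const ua_Xm)) j (- 1)"

definition up :: "int \<Rightarrow> int \<Rightarrow> 'k fps" where
  "up n j = verma_coeff n (rho (uh_const ua_Xp)) j 1"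

text \<open>The relation [H, x] = 2 wdeg(x) x carries over to A, where H acts on v_j by n - 2j
  thanks to g(H) = H. Comparing coefficients, x lowers indices by exactly \<open>wdeg [x]\<close>,
  as k[[h]] is a domain of characteristic zero.\<close>

lemma verma_coeff_rho_letter_eq_0:
  assumes "d \<noteq> wdeg [x]"
  shows "verma_coeff n (rho (uh_const (ua_mono [x] 1))) j d = 0"
proof -
  let ?x = "rho (uh_const (ua_mono [x] 1))" and ?H = "rho (uh_const ua_H)"
  let ?e = "of_int (2 * wdeg [x]) :: 'k"
  have "ua_mult ua_H (ua_mono [x] 1) = ua_mult (ua_mono [x] 1) ua_H + ua_mono [x] (smult ?e 1)"
    by (simp add: ua_H_eq ua_mult_mono pcompose_pCons wt_eq flip: ua_mono_add)
  then have "uh_mult (uh_const ua_H) (uh_const (ua_mono [x] 1)) =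
      uh_mult (uh_const (ua_mono [x] 1)) (uh_const ua_H) +
      uh_smult (fps_const ?e) (uh_const (ua_mono [x] 1))"
    unfolding uh_const_mult uh_smult_const_mono by (simp only: uh_const_add)
  then have "?H * ?x = ?x * ?H + sm (fps_const ?e) ?x"
    by (simp add: ua_H_eq rho_add flip: rho_mult rho_smult)
  then have "verma_coeff n (?H * ?x) j d = verma_coeff n (?x * ?H) j d + fps_const ?e * verma_coeff n ?x j d"
    by (simp add: verma_coeff_add verma_coeff_sm)
  moreover have "verma_coeff n (?H * ?x) j d = verma_coeff n ?x j d * fps_const (of_int (n - 2 * (j - d)))"
    using verma_coeff_mult[of 0 n ?H ?x j d] by (simp add: verma_coeff_H)
  ultimately have "verma_coeff n ?x j d * fps_const (of_int (n - 2 * (j - d))) =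
      verma_coeff n ?x j d * fps_const (of_int (n - 2 * j) + ?e)"
    unfolding verma_coeff_mult_H by (simp only: fps_const_add[symmetric] distrib_left mult.commute)
  then have "verma_coeff n ?x j d = 0 \<or> fps_const (of_int (n - 2 * (j - d))) = fps_const (of_int (n - 2 * j) + ?e)"
    by (simp only: mult_cancel_left)
  moreover have "fps_const (of_int (n - 2 * (j - d))) \<noteq> fps_const (of_int (n - 2 * j) + ?e)"
  proof
    assume eq: "fps_const (of_int (n - 2 * (j - d))) = fps_const (of_int (n - 2 * j) + ?e)"
    have "of_int (n - 2 * (j - d)) = (of_int (n - 2 * j + 2 * wdeg [x]) :: 'k)"
      using arg_cong[OF eq, of "\<lambda>f. fps_nth f 0"] by (simp del: wdeg_simps)
    then have "n - 2 * (j - d) = n - 2 * j + 2 * wdeg [x]" by (simp only: of_int_eq_iff)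
    with assms show False by simp
  qed
  ultimately show ?thesis by blast
qed

text \<open>Both sides are compatible with prefixing a letter to a word and, for the empty word,
  with the Horner step from p to c + H p.\<close>

lemma verma_coeff_rho_const:
  assumes "u \<in> ua_carrier"
  shows "verma_coeff n (rho (uh_const u)) j d = mat_ua (down n) (up n) n u j d"
  using assms
proof (induction rule: ua_carrier_induct)
  case zero
  show ?case using verma_coeff_diff[of n 0 0 j d] by simp
next
  case (mono w p)
  show ?case
  proof (induction w arbitrary: d)
    case Nil
    show ?case
    proof (induction p)
      case 0
      show ?case using verma_coeff_diff[of n 0 0 j d] by simp
    next
      case (pCons c p)
      let ?p = "rho (uh_const (ua_mono [] p))"
      have "ua_mono [] (pCons c p) = ua_mono [] [:c:] + ua_mult ua_H (ua_mono [] p)"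
        by (simp add: ua_H_eq ua_mult_mono wt_def flip: ua_mono_add)
      moreover have "uh_const (ua_mono [] [:c:]) = uh_smult (fps_const c) uh_one"
        by (simp add: uh_one_def ua_one_eq uh_smult_const_mono)
      ultimately have "uh_const (ua_mono [] (pCons c p)) =
          uh_smult (fps_const c) uh_one + uh_mult (uh_const ua_H) (uh_const (ua_mono [] p))"
        by (simp only: uh_const_add uh_const_mult)
      moreover have "(uh_one :: 'k uha) \<in> uh_carrier" "uh_const (ua_H :: 'k ua) \<in> uh_carrier"
        by (simp_all add: uh_one_def ua_one_eq ua_H_eq)
      ultimately have "rho (uh_const (ua_mono [] (pCons c p))) =
          sm (fps_const c) 1 + rho (uh_const ua_H) * ?p"
        by (simp add: rho_add rho_mult rho_smult rho_one)
      moreover have "verma_coeff n (rho (uh_const ua_H) * ?p) j d = verma_coeff n ?p j d * fps_const (of_int (n - 2 * (j - d)))"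
        using verma_coeff_mult[of 0 n "rho (uh_const ua_H)" ?p j d] by (simp add: verma_coeff_H)
      ultimately show ?case
        by (auto simp: verma_coeff_add verma_coeff_sm verma_coeff_one pCons.IH mat_ua_mono mult.commute
            simp del: of_int_diff of_int_mult simp flip: fps_const_add fps_const_mult)
    qed
  next
    case (Cons x w)
    let ?x = "rho (uh_const (ua_mono [x] 1))"
    have "ua_mono (x # w) p = ua_mult (ua_mono [x] 1) (ua_mono w p)" by (simp add: ua_mult_mono)
    then have "rho (uh_const (ua_mono (x # w) p)) = ?x * rho (uh_const (ua_mono w p))"
      by (simp flip: rho_mult uh_const_mult)
    then have "verma_coeff n (rho (uh_const (ua_mono (x # w) p))) j d =
        verma_coeff n (rho (uh_const (ua_mono w p))) j (d - wdeg [x]) * verma_coeff n ?x (j - (d - wdeg [x])) (wdeg [x])"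
      using verma_coeff_mult[of "wdeg [x]" n ?x, OF verma_coeff_rho_letter_eq_0] by simp
    moreover have "verma_coeff n ?x i (wdeg [x]) = (if x then up n i else down n i)" for i
      by (simp add: up_def down_def ua_Xp_eq ua_Xm_eq)
    ultimately show ?case
      by (auto simp: Cons mat_ua_mono mult.assoc)
  qed
next
  case (add u v)
  then show ?case by (simp add: uh_const_add rho_add verma_coeff_add mat_ua_add)
qed

text \<open>By linearity over k[[h]], splitting off \<open>u 0\<close> leaves h times the
  contribution of \<open>uh_shift u\<close>, so each coefficient in h reduces to the preceding
  one.\<close>

lemma verma_coeff_rho:
  assumes "u \<in> uh_carrier"
  shows "verma_coeff n (rho u) j d = mat_uh (down n) (up n) n u j d"
proof -
  have "fps_nth (verma_coeff n (rho u) j d) m = fps_nth (mat_uh (down n) (up n) n u j d) m" for m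
    using assms
  proof (induction m arbitrary: u rule: less_induct)
    case (less m)
    have "rho u = rho (uh_const (u 0)) + sm fps_X (rho (uh_shift u))"
      using less.prems by (subst uh_decompose) (simp add: rho_add rho_smult uh_carrierD)
    with less.prems have "verma_coeff n (rho u) j d =
        mat_ua (down n) (up n) n (u 0) j d + fps_X * verma_coeff n (rho (uh_shift u)) j d"
      by (simp add: verma_coeff_add verma_coeff_sm verma_coeff_rho_const uh_carrierD)
    moreover note mat_uh_decompose[of "down n" "up n" n u j d]
    ultimately show ?case using less by simp
  qed
  then show ?thesis by (simp add: fps_eq_iff)
qed

section \<open>Reduction modulo h and surjectivity of rho\<close>

lemma rho_const_modh:
  assumes "u \<in> ua_carrier"
  shows "\<exists>b. rho (uh_const u) = g (usl2h_const (sl2_cls u)) + sm fps_X b"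
proof -
  have "modh sm (g (usl2h_const (sl2_cls u))) = modh sm (rho (uh_const u))"
    using g_iso assms by (simp add: a_alg_iso_sl2_def)
  moreover have "rho (uh_const u) \<in> modh sm (rho (uh_const u))"
    by (simp add: modh_def) (metis sm_0 rangeI)
  ultimately have "rho (uh_const u) - g (usl2h_const (sl2_cls u)) \<in> range (sm fps_X)"
    by (auto simp: modh_def)
  then show ?thesis by (auto simp: algebra_simps)
qed

text \<open>Modulo h, rho and g agree on U(a), because the reduction of g respects the structural
  maps.\<close>

lemma verma_coeff_rho_const_nth_0:
  assumes "u \<in> ua_carrier"
  shows "fps_nth (verma_coeff n (rho (uh_const u)) j d) 0 = fps_nth (verma_ua n u j d) 0"
  using rho_const_modh[OF assms] assms by (auto simp: verma_coeff_add verma_coeff_sm verma_coeff_g_const)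

lemma down_nth_0: "fps_nth (down n j) 0 = 1"
  by (simp add: down_def verma_coeff_rho_const_nth_0 ua_Xm_eq mat_ua_mono)

lemma up_nth_0: "fps_nth (up n j) 0 = of_int (j * (n - j + 1))"
  by (simp add: up_def verma_coeff_rho_const_nth_0 ua_Xp_eq mat_ua_mono verma_up_def)

lemma up_0: "up n 0 = 0"
  by (simp add: up_def verma_coeff_def mat_uh_eq_0)

text \<open>Elements of the ideal act by zero on the Verma modules, so the part coming from g in
  \<open>rho_const_modh\<close> vanishes by faithfulness.\<close>

lemma rho_sl2_ideal:
  assumes "x \<in> sl2_ideal"
  shows "\<exists>b. rho (uh_const x) = sm fps_X b"
proof -
  obtain b where b: "rho (uh_const x) = g (usl2h_const (sl2_cls x)) + sm fps_X b"
    using rho_const_modh sl2_ideal_carrier[OF assms] by blast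
  have "verma_coeff n (g (usl2h_const (sl2_cls x))) j d = 0" for n j d
    using assms by (simp add: verma_coeff_g_const verma_ua_sl2_ideal sl2_ideal_carrier)
  then have "g (usl2h_const (sl2_cls x)) = 0" by (rule verma_coeff_faithful)
  with b show ?thesis by auto
qed

lemma rho_surj: "\<exists>u\<in>uh_carrier. rho u = a"
proof -
  have "\<exists>u b. u \<in> ua_carrier \<and> a = rho (uh_const u) + sm fps_X b" for a
  proof -
    have "modh sm a \<in> (\<lambda>C. modh sm (g (usl2h_const C))) ` Usl2"
      using g_iso unfolding a_alg_iso_sl2_def bij_betw_def by auto
    then obtain u where u: "u \<in> ua_carrier" "modh sm a = modh sm (g (usl2h_const (sl2_cls u)))"
      by (auto simp: Usl2_def)
    with g_iso have "modh sm a = modh sm (rho (uh_const u))" by (simp add: a_alg_iso_sl2_def)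
    moreover have "a \<in> modh sm a" by (simp add: modh_def) (metis sm_0 rangeI)
    ultimately have "a - rho (uh_const u) \<in> range (sm fps_X)" by (auto simp: modh_def)
    with u(1) show ?thesis by (auto simp: algebra_simps intro!: exI[of _ u])
  qed
  then obtain f r where fr: "\<And>a. f a \<in> ua_carrier" "\<And>a. a = rho (uh_const (f a)) + sm fps_X (r a)"
    by metis
  \<comment> \<open>Iterating a = rho(f a) + h r(a) expands a in powers of h; these are the
    coefficients.\<close>
  define U where "U a = (\<lambda>m. f ((r ^^ m) a))" for a
  have U: "U a \<in> uh_carrier" for a by (simp add: U_def uh_carrierI fr)
  have "rho (U a) - a = sm fps_X (rho (U (r a)) - r a)" for a
  proof -
    have "uh_shift (U a) = U (r a)" "U a 0 = f a"
      by (simp_all add: U_def uh_shift_def funpow_swap1)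
    then have "rho (U a) = rho (uh_const (f a)) + sm fps_X (rho (U (r a)))"
      using U fr(1) by (subst uh_decompose) (simp add: rho_add rho_smult)
    with fr(2)[of a] show ?thesis by (simp add: sm_diff algebra_simps)
  qed
  \<comment> \<open>The error for a is h times the error for \<open>r a\<close>. Hence its Verma
    coefficients are divisible by every power of h, and faithfulness makes it vanish.\<close>
  then have step: "verma_coeff n (rho (U a) - a) j d = fps_X * verma_coeff n (rho (U (r a)) - r a) j d" for n j d a
    by (metis verma_coeff_sm)
  have "fps_nth (verma_coeff n (rho (U a) - a) j d) m = 0" for n j d m a
  proof (induction m arbitrary: a)
    case (Suc m)
    show ?case by (subst step) (simp add: Suc)
  qed (subst step, simp)
  then have "rho (U a) - a = 0" by (intro verma_coeff_faithful) (simp add: fps_eq_iff)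
  with U show ?thesis by auto
qed

text \<open>The coefficient of X+ in the basis (X-)^k v_0 of M(n)[[h]], as in
  \<open>word_coeff_rescale\<close>.\<close>

definition colouring :: "nat \<Rightarrow> int \<Rightarrow> 'k fps" where
  "colouring k n = up n (int k) * down n (int k - 1)"

lemma is_regular_colouring_colouring: "is_regular_colouring colouring"
proof -
  have 1: "fps_nth (colouring k n) 0 = of_nat k * (of_int n - of_nat k + 1)" for k n
    by (simp add: colouring_def up_nth_0 down_nth_0)
  have refl: "up (int n) (int n + 1 + k) = up (- int n - 2) k"
    "down (int n) (int n + 1 + k) = down (- int n - 2) k" for n k
    by (simp_all add: up_def down_def verma_coeff_reflect)
  \<comment> \<open>Reflection turns index n + 1 into index 0, where \<open>up\<close>
    vanishes.\<close>
  have 2: "colouring (n + 1) (int n) = 0" for n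
    using refl(1)[of n 0] by (simp add: colouring_def up_0 add.commute)
  have 3: "colouring (n + k + 1) (int n) = colouring k (- int n - 2)" for n k
    using refl[of n "int k"] refl(2)[of n "int k - 1"] by (simp add: colouring_def algebra_simps)
  have "polynomial_fps_fun (\<lambda>j n. up n j * down n (j - 1))"
    using polynomial_fps_fun_verma_uh[of "lift (rho (uh_const ua_Xp))" 1]
      polynomial_fps_fun_verma_uh[of "lift (rho (uh_const ua_Xm))" "- 1"]
    by (intro polynomial_fps_fun_mult)
      (auto simp: up_def[abs_def] down_def[abs_def] verma_coeff_def polynomial_fps_fun_def intro: polynomial_fun_shift)
  then have "\<exists>P. \<forall>j n. fps_nth (up n j * down n (j - 1)) m = eval2 P (of_int j) (of_int n)" for m
    by (simp add: polynomial_fps_fun_def polynomial_fun_def)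
  then have "\<exists>P. \<forall>k\<ge>1. \<forall>n::int. fps_nth (colouring k n) m = eval2 P (of_nat k) (of_int n)" for m
    unfolding colouring_def by (metis of_int_of_nat_eq)
  with 1 2 3 show ?thesis by (auto simp: is_regular_colouring_def is_colouring_def)
qed

text \<open>V_h(n, colouring) is M(n)[[h]] in a rescaled basis, and A acts faithfully on the sum of
  these modules.\<close>

lemma ann_ideal_colouring: "ann_ideal colouring = {u \<in> uh_carrier. rho u = 0}"
proof -
  \<comment> \<open>These products have constant term 1, so they can be cancelled after
    \<open>mat_uh_rescale\<close>.\<close>
  have nz: "(\<Prod>l<k. down n (int l)) \<noteq> 0" for k n
    using down_nth_0[of n] by (auto dest: arg_cong[of _ _ "\<lambda>f. fps_nth f 0"])
  have verma_coeff: "verma_coeff n (rho u) (int k) (int k - int j) = 0 \<longleftrightarrow>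
      colour_uh colouring n u (int k) (int k - int j) = 0" if "u \<in> uh_carrier" for u n k j
  proof -
    have "mat_uh (down n) (up n) n u (int k) (int k - int j) * (\<Prod>l<k. down n (int l)) =
        colour_uh colouring n u (int k) (int k - int j) * (\<Prod>l<j. down n (int l))"
      by (rule mat_uh_rescale) (auto simp: up_0 colour_up_def colouring_def)
    with nz show ?thesis unfolding verma_coeff_rho[OF that] by (metis mult_eq_0_iff)
  qed
  have "rho u = 0 \<longleftrightarrow> (\<forall>n k j. colour_uh colouring n u (int k) (int k - int j) = 0)"
    if u: "u \<in> uh_carrier" for u
  proof
    assume "rho u = 0"
    moreover have "verma_coeff n 0 j d = 0" for n j d using verma_coeff_diff[of n 0 0] by simp
    ultimately show "\<forall>n k j. colour_uh colouring n u (int k) (int k - int j) = 0"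
      using verma_coeff[OF u] by simp
  next
    assume zero: "\<forall>n k j. colour_uh colouring n u (int k) (int k - int j) = 0"
    show "rho u = 0"
    proof (rule verma_coeff_faithful)
      fix n j d :: int
      assume j: "0 \<le> j"
      show "verma_coeff n (rho u) j d = 0"
      proof (cases "d \<le> j")
        case True
        with j verma_coeff[OF u, of n "nat j" "nat (j - d)"] zero[rule_format, of n "nat j" "nat (j - d)"]
        show ?thesis by simp
      next
        \<comment> \<open>The target index j - d is negative, hence outside the Verma
          module.\<close>
        case False
        with j show ?thesis unfolding verma_coeff_def by (intro mat_uh_eq_0) auto
      qed
    qed
  qed
  then show ?thesis by (auto simp: ann_ideal_iff)
qed

end

section \<open>Uniqueness\<close>

text \<open>A letter X+ at the right end kills the highest weight vector, so only powers of X-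
  survive, and they have coefficient 1.\<close>

lemma mat_ua_normally_ordered:
  assumes "normally_ordered v" "b 0 = 0" "b' 0 = 0"
  shows "mat_ua (\<lambda>_. 1) b n v 0 d = mat_ua (\<lambda>_. 1) b' n v 0 d"
  unfolding mat_ua_def
proof (rule sum.cong[OF refl])
  fix w assume "w \<in> {w. v w \<noteq> 0}"
  then obtain a c where w: "w = replicate a False @ replicate c True"
    using assms(1) unfolding normally_ordered_def normal_word_def by auto
  have "word_coeff (\<lambda>_. 1) b w 0 = (if c = 0 then 1 else 0)" if "b 0 = 0" for b :: "int \<Rightarrow> 'a fps"
    using word_coeff_eq_0[of b 0 "replicate c True" "\<lambda>_. 1"] that
    unfolding w word_coeff_append by auto
  with assms show "(if wdeg w = d then fps_const (poly (v w) (of_int (n - 2 * 0))) *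
        word_coeff (\<lambda>_. 1) b w 0 else 0) =
      (if wdeg w = d then fps_const (poly (v w) (of_int (n - 2 * 0))) * word_coeff (\<lambda>_. 1) b' w 0 else 0)"
    by simp
qed

lemma colour_uh_raise_lower:
  "colour_uh psi n (uh_const (ua_mono (replicate k True @ replicate k False) 1)) 0 0 =
    (\<Prod>i<k. psi (Suc i) n)"
proof -
  have "colour_uh psi n (uh_const (ua_mono (replicate k True @ replicate k False) 1)) 0 0 =
      (\<Prod>l<k. colour_up psi n (int k - int l))"
    by (simp add: mat_ua_mono word_coeff_append word_coeff_replicate_True)
  also have "\<dots> = (\<Prod>l<k. (\<lambda>i. psi (Suc i) n) (k - Suc l))"
    by (intro prod.cong) (auto simp: colour_up_def Suc_diff_Suc nat_diff_distrib)
  also have "\<dots> = (\<Prod>i<k. psi (Suc i) n)"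
    by (rule prod.nat_diff_reindex)
  finally show ?thesis .
qed

lemma colouring_eqI:
  fixes psi psi' :: "nat \<Rightarrow> int \<Rightarrow> 'k::field_char_0 fps"
  assumes col: "is_colouring psi" "is_colouring psi'"
    and prod: "\<And>k n. (\<Prod>i<k. psi (Suc i) n) = (\<Prod>i<k. psi' (Suc i) n)"
    and "1 \<le> k"
  shows "psi k n = psi' k n"
proof -
  \<comment> \<open>By (C1) the factor psi^(i+1)(n) has constant term (i+1)(n-i). If n is none of 0,
    ..., m-1, the first m factors can be cancelled from the product of m+1 factors.\<close>
  have generic: "psi (Suc m) n = psi' (Suc m) n" if "\<And>i. i < m \<Longrightarrow> n \<noteq> int i" for m :: nat and n :: int
  proof -
    have "psi (Suc i) n \<noteq> 0" if "i < m" for i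
    proof -
      have "fps_nth (psi (Suc i) n) 0 = of_int (int (Suc i) * (n - int i))"
        using col(1) unfolding is_colouring_def by simp
      also have "\<dots> \<noteq> 0"
        using \<open>\<And>i. i < m \<Longrightarrow> n \<noteq> int i\<close>[OF that] unfolding of_int_eq_0_iff by simp
      finally show ?thesis by auto
    qed
    then have "(\<Prod>i<m. psi (Suc i) n) \<noteq> 0" by simp
    with prod[of n "Suc m"] prod[of n m] show ?thesis by simp
  qed
  obtain m where m: "k = Suc m" using \<open>1 \<le> k\<close> by (cases k) auto
  show ?thesis
  proof (cases "\<exists>i<m. n = int i")
    case True
    then obtain i where i: "i < m" "n = int i" by blast
    \<comment> \<open>For n = i < m, (C3) replaces psi^(m+1)(n) by psi^(l+1)(-n-2), whose argument
      is negative and hence generic.\<close>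
    then obtain l where l: "m = i + Suc l" by (metis less_imp_Suc_add add_Suc_right)
    have "psi k n = psi (Suc l) (- int i - 2)" "psi' k n = psi' (Suc l) (- int i - 2)"
      using col[unfolded is_colouring_def] unfolding m l i(2)
      by (metis Suc_eq_plus1 le_add2)+
    moreover have "psi (Suc l) (- int i - 2) = psi' (Suc l) (- int i - 2)"
      by (rule generic) simp
    ultimately show ?thesis by simp
  next
    case False
    then show ?thesis unfolding m by (intro generic) auto
  qed
qed

section \<open>The isomorphism for the constructed colouring, and uniqueness\<close>

context trivialized_deformation
begin

text \<open>The homomorphism theorem: the classes modulo the annihilator are the fibres of rho on
  \<open>uh_carrier\<close>, and rho is surjective, so evaluating rho on representatives gives the
  isomorphism.\<close>

lemma Uh_alg_iso_colouring: "Uh_alg_iso_Uh_psi sm rho colouring"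
proof -
  have cls: "psi_cls colouring u = {v \<in> uh_carrier. rho v = rho u}" if "u \<in> uh_carrier" for u
    using that by (auto simp: psi_cls_def ann_ideal_colouring uh_sub_eq rho_diff)
  have rep: "rho (rep (psi_cls colouring u)) = rho u" if "u \<in> uh_carrier" for u
  proof -
    have "rep (psi_cls colouring u) \<in> psi_cls colouring u"
      unfolding rep_def using that cls[OF that] by (intro someI[of "\<lambda>x. x \<in> psi_cls colouring u"]) simp
    then show ?thesis using cls[OF that] by simp
  qed
  have "bij_betw (\<lambda>C. rho (rep C)) (Uh_psi colouring) UNIV"
    unfolding bij_betw_def
  proof
    show "inj_on (\<lambda>C. rho (rep C)) (Uh_psi colouring)"
    proof (rule inj_onI)
      fix C D
      assume "C \<in> Uh_psi colouring" "D \<in> Uh_psi colouring" and eq: "rho (rep C) = rho (rep D)"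
      then obtain u v where "u \<in> uh_carrier" "C = psi_cls colouring u"
        "v \<in> uh_carrier" "D = psi_cls colouring v"
        unfolding Uh_psi_def by blast
      with eq rep cls show "C = D" by simp
    qed
    show "(\<lambda>C. rho (rep C)) ` Uh_psi colouring = UNIV"
    proof (intro set_eqI iffI UNIV_I)
      fix a
      obtain u where u: "u \<in> uh_carrier" "rho u = a" using rho_surj by blast
      then show "a \<in> (\<lambda>C. rho (rep C)) ` Uh_psi colouring"
        unfolding Uh_psi_def image_image using rep[of u] by (intro image_eqI[of _ _ u]) auto
    qed
  qed
  moreover have "uh_one \<in> (uh_carrier :: 'k uha set)" by (simp add: uh_one_def ua_one_eq)
  ultimately show ?thesis
    unfolding Uh_alg_iso_Uh_psi_def
    by (intro exI[of _ "\<lambda>C. rho (rep C)"])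
      (simp add: rep rho_one rho_add rho_mult rho_smult uh_add_eq)
qed

lemma Uh_alg_iso_ker_subset_ann_ideal:
  assumes "Uh_alg_iso_Uh_psi sm rho psi" "u \<in> uh_carrier" "rho u = 0"
  shows "u \<in> ann_ideal psi"
proof -
  obtain Phi where Phi: "inj_on Phi (Uh_psi psi)" "\<And>u. u \<in> uh_carrier \<Longrightarrow> Phi (psi_cls psi u) = rho u"
    using assms(1) unfolding Uh_alg_iso_Uh_psi_def bij_betw_def by blast
  have "psi_cls psi u = psi_cls psi 0"
    using Phi assms by (intro inj_onD[OF Phi(1)]) (auto simp: Uh_psi_def)
  moreover have "u \<in> psi_cls psi u"
    using assms(2) by (simp add: psi_cls_def uh_sub_eq ann_ideal_iff)
  ultimately have "u \<in> psi_cls psi 0" by simp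
  then show ?thesis by (simp add: psi_cls_def uh_sub_eq)
qed

text \<open>Modulo h every element is normally ordered, and normally ordered elements act on the
highest weight vector independently of the colouring.\<close>
lemma colour_uh_highest_weight_unique:
  assumes psi: "\<And>u. u \<in> uh_carrier \<Longrightarrow> rho u = 0 \<Longrightarrow> u \<in> ann_ideal psi"
    and psi': "\<And>u. u \<in> uh_carrier \<Longrightarrow> rho u = 0 \<Longrightarrow> u \<in> ann_ideal psi'"
    and "u \<in> uh_carrier"
  shows "colour_uh psi n u 0 (- int j) = colour_uh psi' n u 0 (- int j)"
proof -
  have "fps_nth (colour_uh psi n u 0 (- int j)) N = fps_nth (colour_uh psi' n u 0 (- int j)) N" for N
    using assms(3)
  proof (induction N arbitrary: u rule: less_induct)
    case (less N)
    obtain v where v: "normally_ordered v" "u 0 - v \<in> sl2_ideal"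
      using reducible_to_normal[of "u 0"] less.prems
      unfolding reducible_to_normal_def by (auto simp: uh_carrierD)
    then have vc: "v \<in> ua_carrier" by (simp add: normally_ordered_def)
    \<comment> \<open>On an ideal element rho takes a value in hA, which surjectivity writes as h
      rho(w). So \<open>?z\<close> below lies in the kernel.\<close>
    obtain w where w: "w \<in> uh_carrier" "rho (uh_const (u 0 - v)) = sm fps_X (rho w)"
      using rho_sl2_ideal[OF v(2)] rho_surj by metis
    let ?z = "uh_const (u 0 - v) - uh_smult fps_X w"
    have z: "?z \<in> uh_carrier" "rho ?z = 0"
      using w vc less.prems by (simp_all add: rho_diff rho_smult uh_carrierD)
    \<comment> \<open>Apart from the contribution of v, the action of u on b_0 is h times those of w
      and \<open>uh_shift u\<close>, to which the induction hypothesis for smaller orders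
      applies.\<close>
    have decomp: "colour_uh phi n u 0 (- int j) = mat_ua (\<lambda>_. 1) (colour_up phi n) n v 0 (- int j) +
        fps_X * (colour_uh phi n w 0 (- int j) + colour_uh phi n (uh_shift u) 0 (- int j))"
      if "?z \<in> ann_ideal phi" for phi
    proof -
      have "colour_uh phi n ?z (int 0) (int 0 - int j) = 0"
        using that by (simp only: ann_ideal_iff)
      then have "mat_ua (\<lambda>_. 1) (colour_up phi n) n (u 0) 0 (- int j) =
          mat_ua (\<lambda>_. 1) (colour_up phi n) n v 0 (- int j) + fps_X * colour_uh phi n w 0 (- int j)"
        using w vc less.prems
        by (simp add: mat_uh_diff mat_uh_X mat_ua_diff uh_carrierD algebra_simps)
      then show ?thesis
        using mat_uh_decompose[of "\<lambda>_. 1" "colour_up phi n" n u 0 "- int j"]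
        by (simp add: algebra_simps)
    qed
    have "mat_ua (\<lambda>_. 1) (colour_up psi n) n v 0 (- int j) =
        mat_ua (\<lambda>_. 1) (colour_up psi' n) n v 0 (- int j)"
      by (rule mat_ua_normally_ordered[OF v(1)]) simp_all
    then show ?case
      unfolding decomp[OF psi[OF z]] decomp[OF psi'[OF z]]
      using less.IH w(1) less.prems by simp
  qed
  then show ?thesis by (simp add: fps_eq_iff)
qed

lemma colouring_unique:
  assumes "is_colouring psi" "Uh_alg_iso_Uh_psi sm rho psi" "1 \<le> k"
  shows "psi k = colouring k"
proof
  fix n
  have prod: "(\<Prod>i<k. psi (Suc i) n) = (\<Prod>i<k. colouring (Suc i) n)" for k n
  proof -
    have "colour_uh psi n u 0 (- int 0) = colour_uh colouring n u 0 (- int 0)" if "u \<in> uh_carrier" for u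
      using Uh_alg_iso_ker_subset_ann_ideal[OF assms(2)]
        Uh_alg_iso_ker_subset_ann_ideal[OF Uh_alg_iso_colouring] that
      by (rule colour_uh_highest_weight_unique)
    from this[of "uh_const (ua_mono (replicate k True @ replicate k False) 1)"]
    show ?thesis using colour_uh_raise_lower[of psi n k] colour_uh_raise_lower[of colouring n k]
      by simp
  qed
  have "is_colouring colouring"
    using is_regular_colouring_colouring by (simp add: is_regular_colouring_def)
  from assms(1) this prod assms(3) show "psi k n = colouring k n" by (rule colouring_eqI)
qed

end

theorem mainTheorem11:
  fixes sm :: "'k::field_char_0 fps \<Rightarrow> 'a::ring_1 \<Rightarrow> 'a"
    and rho :: "'k uha \<Rightarrow> 'a"
    and vs :: "'k \<Rightarrow> 'v::ab_group_add \<Rightarrow> 'v"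
    and e :: "(nat \<Rightarrow> 'v) \<Rightarrow> 'a"
  assumes struct: "Uh_structure sm rho"
    and top_free: "topologically_free_iso vs sm e"
    and deformation: "deformation_of_Usl2 sm rho"
    and htriv: "h_trivial sm rho"
  shows "\<exists>psi. is_regular_colouring psi \<and> Uh_alg_iso_Uh_psi sm rho psi \<and>
           (\<forall>psi'. is_regular_colouring psi' \<and> Uh_alg_iso_Uh_psi sm rho psi' \<longrightarrow>
              (\<forall>k\<ge>1. psi' k = psi k))"
proof -
  obtain g where "trivialized_deformation sm rho g"
    using struct htriv unfolding h_trivial_def trivialized_deformation_def by blast
  then interpret trivialized_deformation sm rho g .
  show ?thesis
    using is_regular_colouring_colouring Uh_alg_iso_colouring colouring_unique
    unfolding is_regular_colouring_def by blast
qed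

end
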